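(* There exists an absolute constant $c>0$ such that, for any positive integers $p=p_n$ and positive reals $\sigma=\sigma_n$, $\Delta=\Delta_n$ (possibly depending on $n$), there exists a sequence $\epsilon_n=o(1)$ such that for all $n$ large enough $$\Psi_\Delta\ge c\,\Phi^{\mathsf c}\left(\mathbf r_n(1+\epsilon_n)\right),\qquad\text{where } \mathbf r_n=\frac{\Delta^2/\sigma^2}{\sqrt{\Delta^2/\sigma^2+p/n}} .$$
   Context: Model: for $n\ge 2$, $p\ge1$, $\sigma>0$, one observes $Y_i=\boldsymbol\theta\eta_i+\sigma\xi_i\in\mathbf R^p$, $i=1,\dots,n$, where $\boldsymbol\theta\in\mathbf R^p$ and $\eta\in\{-1,1\}^n$ are unknown and $\xi_1,\dots,\xi_n$ are i.i.d. standard Gaussian vectors in $\mathbf R^p$. $Y$ is the $p\times n$ matrix with columns $Y_1,\dots,Y_n$; $\mathbf E_{(\boldsymbol\theta,\eta)}$ is expectation under the law of $Y$. $\|\cdot\|$ is the Euclidean norm. $\Phi^{\mathsf c}(t)=\mathbf P(z>t)$ for $z$ standard Gaussian. $\Omega_\Delta=\{\boldsymbol\theta\in\mathbf R^p:\|\boldsymbol\theta\|\ge\Delta\}\times\{-1,1\}^n$. Loss: $r(\hat\eta,\eta)=\min_{\nu\in\{-1,1\}}\sum_{j=1}^n|\hat\eta_j-\nu\eta_j|$. Minimax risk: $\Psi_\Delta=\inf_{\tilde\eta}\sup_{(\boldsymbol\theta,\eta)\in\Omega_\Delta}\frac1n\mathbf E_{(\boldsymbol\theta,\eta)}r(\tilde\eta,\eta)$,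 the infimum being over all measurable functions $\tilde\eta$ of $Y$ with values in $\{-1,1\}^n$. The parameters $p,\sigma,\Delta$ may depend on $n$, and asymptotics are as $n\to\infty$. *)

theory Defs
  imports "HOL-Probability.Probability"
begin

text \<open>
  Vectors in \<open>\<real>^p\<close> are functions supported (in the sense of \<open>extensional\<close>) on \<open>{..<p}\<close>, since the
  dimension varies with the sample size. An observation is a family of \<open>n\<close> such vectors: \<open>y i j\<close> is
  the \<open>j\<close>-th coordinate of the \<open>i\<close>-th observed vector, i.e. the matrix \<open>Y\<close> is stored by columns.
\<close>

definition std_gaussian_vector :: "nat \<Rightarrow> (nat \<Rightarrow> real) measure" where
  "std_gaussian_vector p = (\<Pi>\<^sub>M j\<in>{..<p}. std_normal_distribution)"

definition noise :: "nat \<Rightarrow> nat \<Rightarrow> (nat \<Rightarrow> nat \<Rightarrow> real) measure" where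
  "noise n p = (\<Pi>\<^sub>M i\<in>{..<n}. std_gaussian_vector p)"

definition obs_space :: "nat \<Rightarrow> nat \<Rightarrow> (nat \<Rightarrow> nat \<Rightarrow> real) measure" where
  "obs_space n p = (\<Pi>\<^sub>M i\<in>{..<n}. \<Pi>\<^sub>M j\<in>{..<p}. borel)"

definition labels :: "nat \<Rightarrow> (nat \<Rightarrow> real) set" where
  "labels n = {..<n} \<rightarrow>\<^sub>E {-1, 1}"

definition observation ::
  "nat \<Rightarrow> nat \<Rightarrow> real \<Rightarrow> (nat \<Rightarrow> real) \<Rightarrow> (nat \<Rightarrow> real) \<Rightarrow> (nat \<Rightarrow> nat \<Rightarrow> real) \<Rightarrow> (nat \<Rightarrow> nat \<Rightarrow> real)" where
  "observation n p \<sigma> \<theta> \<eta> \<xi> = (\<lambda>i\<in>{..<n}. \<lambda>j\<in>{..<p}. \<theta> j * \<eta> i + \<sigma> * \<xi> i j)"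

definition obs_law ::
  "nat \<Rightarrow> nat \<Rightarrow> real \<Rightarrow> (nat \<Rightarrow> real) \<Rightarrow> (nat \<Rightarrow> real) \<Rightarrow> (nat \<Rightarrow> nat \<Rightarrow> real) measure" where
  "obs_law n p \<sigma> \<theta> \<eta> = distr (noise n p) (obs_space n p) (observation n p \<sigma> \<theta> \<eta>)"

definition param_space :: "nat \<Rightarrow> nat \<Rightarrow> real \<Rightarrow> ((nat \<Rightarrow> real) \<times> (nat \<Rightarrow> real)) set" where
  "param_space n p \<Delta> = {\<theta> \<in> extensional {..<p}. L2_set \<theta> {..<p} \<ge> \<Delta>} \<times> labels n"

definition estimators :: "nat \<Rightarrow> nat \<Rightarrow> ((nat \<Rightarrow> nat \<Rightarrow> real) \<Rightarrow> (nat \<Rightarrow> real)) set" where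
  "estimators n p = obs_space n p \<rightarrow>\<^sub>M count_space (labels n)"

definition loss :: "nat \<Rightarrow> (nat \<Rightarrow> real) \<Rightarrow> (nat \<Rightarrow> real) \<Rightarrow> real" where
  "loss n \<eta>' \<eta> = (MIN \<nu>\<in>{-1, 1}. \<Sum>j<n. \<bar>\<eta>' j - \<nu> * \<eta> j\<bar>)"

definition risk ::
  "nat \<Rightarrow> nat \<Rightarrow> real \<Rightarrow> ((nat \<Rightarrow> nat \<Rightarrow> real) \<Rightarrow> (nat \<Rightarrow> real)) \<Rightarrow> (nat \<Rightarrow> real) \<Rightarrow> (nat \<Rightarrow> real) \<Rightarrow> real" where
  "risk n p \<sigma> est \<theta> \<eta> = (1 / real n) * (LINT y|obs_law n p \<sigma> \<theta> \<eta>. loss n (est y) \<eta>)"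

definition minimax_risk :: "nat \<Rightarrow> nat \<Rightarrow> real \<Rightarrow> real \<Rightarrow> real" where
  "minimax_risk n p \<sigma> \<Delta> =
     (INF est\<in>estimators n p. SUP (\<theta>, \<eta>)\<in>param_space n p \<Delta>. risk n p \<sigma> est \<theta> \<eta>)"

definition normal_tail :: "real \<Rightarrow> real" where
  "normal_tail t = measure std_normal_distribution {t<..}"

definition snr :: "nat \<Rightarrow> nat \<Rightarrow> real \<Rightarrow> real \<Rightarrow> real" where
  "snr n p \<sigma> \<Delta> = (\<Delta>\<^sup>2 / \<sigma>\<^sup>2) / sqrt (\<Delta>\<^sup>2 / \<sigma>\<^sup>2 + real p / real n)"

text \<open>
  \<open>INF\<close> and \<open>SUP\<close> above are taken in the reals, where they are meaningful only for nonempty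
  bounded sets, and the Bochner integral only for integrable functions. The following facts show
  that these conditions hold.
\<close>

lemma measurable_observation:
  "observation n p \<sigma> \<theta> \<eta> \<in> noise n p \<rightarrow>\<^sub>M obs_space n p"
proof -
  have "(\<lambda>\<xi>. \<xi> i j) \<in> borel_measurable (noise n p)" if "i < n" "j < p" for i j
  proof -
    have "(\<lambda>\<xi>. \<xi> i) \<in> noise n p \<rightarrow>\<^sub>M std_gaussian_vector p"
      unfolding noise_def using that by (intro measurable_component_singleton) simp
    moreover have "(\<lambda>x. x j) \<in> std_gaussian_vector p \<rightarrow>\<^sub>M std_normal_distribution"
      unfolding std_gaussian_vector_def using that by (intro measurable_component_singleton) simp
    ultimately have "(\<lambda>\<xi>. \<xi> i j) \<in> noise n p \<rightarrow>\<^sub>M std_normal_distribution"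
      by (rule measurable_compose)
    then show ?thesis by simp
  qed
  then show ?thesis
    unfolding observation_def obs_space_def
    by (intro measurable_restrict borel_measurable_add borel_measurable_times) auto
qed

lemma prob_space_obs_law: "prob_space (obs_law n p \<sigma> \<theta> \<eta>)"
proof -
  have 1: "prob_space (std_gaussian_vector p)"
    unfolding std_gaussian_vector_def
    by (intro prob_space_PiM prob_space_normal_density) simp
  have "prob_space (noise n p)"
    unfolding noise_def by (intro prob_space_PiM 1)
  then show ?thesis
    unfolding obs_law_def by (rule prob_space.prob_space_distr[OF _ measurable_observation])
qed

lemma loss_bounds:
  assumes "\<eta>' \<in> labels n" "\<eta> \<in> labels n"
  shows "0 \<le> loss n \<eta>' \<eta>" "loss n \<eta>' \<eta> \<le> 2 * real n"
proof -
  show "0 \<le> loss n \<eta>' \<eta>"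
    by (auto simp: loss_def intro!: sum_nonneg)
  have "\<bar>\<eta>' j - 1 * \<eta> j\<bar> \<le> 2" if "j < n" for j
  proof -
    have "\<eta>' j \<in> {-1, 1}" "\<eta> j \<in> {-1, 1}"
      using assms that by (auto simp: labels_def PiE_iff)
    then show ?thesis by auto
  qed
  then have "(\<Sum>j<n. \<bar>\<eta>' j - 1 * \<eta> j\<bar>) \<le> (\<Sum>j<n. 2)"
    by (intro sum_mono) simp
  moreover have "loss n \<eta>' \<eta> \<le> (\<Sum>j<n. \<bar>\<eta>' j - 1 * \<eta> j\<bar>)"
    unfolding loss_def by (intro Min_le) auto
  ultimately show "loss n \<eta>' \<eta> \<le> 2 * real n" by simp
qed

lemma integrable_loss:
  assumes "est \<in> estimators n p" "\<eta> \<in> labels n"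
  shows "integrable (obs_law n p \<sigma> \<theta> \<eta>) (\<lambda>y. loss n (est y) \<eta>)"
proof -
  interpret prob_space "obs_law n p \<sigma> \<theta> \<eta>" by (rule prob_space_obs_law)
  have est: "est \<in> obs_law n p \<sigma> \<theta> \<eta> \<rightarrow>\<^sub>M count_space (labels n)"
    using assms(1) by (simp add: estimators_def obs_law_def)
  have "(\<lambda>y. loss n (est y) \<eta>) \<in> borel_measurable (obs_law n p \<sigma> \<theta> \<eta>)"
    by (rule measurable_compose[OF est]) simp
  moreover have "AE y in obs_law n p \<sigma> \<theta> \<eta>. norm (loss n (est y) \<eta>) \<le> 2 * real n"
    using measurable_space[OF est] loss_bounds[OF _ assms(2)] by (intro AE_I2) simp
  ultimately show ?thesis by (intro integrable_const_bound)
qed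

lemma risk_bounds:
  assumes "n > 0" "est \<in> estimators n p" "\<eta> \<in> labels n"
  shows "0 \<le> risk n p \<sigma> est \<theta> \<eta>" "risk n p \<sigma> est \<theta> \<eta> \<le> 2"
proof -
  interpret prob_space "obs_law n p \<sigma> \<theta> \<eta>" by (rule prob_space_obs_law)
  have "est \<in> obs_law n p \<sigma> \<theta> \<eta> \<rightarrow>\<^sub>M count_space (labels n)"
    using assms(2) by (simp add: estimators_def obs_law_def)
  note bd = loss_bounds[OF measurable_space[OF this, simplified space_count_space] assms(3)]
  have "0 \<le> (LINT y|obs_law n p \<sigma> \<theta> \<eta>. loss n (est y) \<eta>)"
    by (intro integral_nonneg_AE AE_I2 bd)
  moreover have "(LINT y|obs_law n p \<sigma> \<theta> \<eta>. loss n (est y) \<eta>) \<le> 2 * real n"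
    using bd by (intro integral_le_const integrable_loss assms AE_I2)
  ultimately show "0 \<le> risk n p \<sigma> est \<theta> \<eta>" "risk n p \<sigma> est \<theta> \<eta> \<le> 2"
    using assms(1) by (simp_all add: risk_def field_simps)
qed

lemma param_space_nonempty:
  assumes "p > 0" shows "param_space n p \<Delta> \<noteq> {}"
proof -
  let ?\<theta> = "\<lambda>j\<in>{..<p}. if j = 0 then \<bar>\<Delta>\<bar> else 0"
  have "L2_set ?\<theta> {..<p} \<ge> ?\<theta> 0"
    using assms by (intro member_le_L2_set) auto
  then have "?\<theta> \<in> {\<theta> \<in> extensional {..<p}. L2_set \<theta> {..<p} \<ge> \<Delta>}"
    using assms by simp
  moreover have "(\<lambda>i\<in>{..<n}. 1) \<in> labels n" by (simp add: labels_def)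
  ultimately show ?thesis unfolding param_space_def by blast
qed

lemma estimators_nonempty: "estimators n p \<noteq> {}"
proof -
  have "(\<lambda>i\<in>{..<n}. 1) \<in> labels n" by (simp add: labels_def)
  then have "(\<lambda>_. \<lambda>i\<in>{..<n}. 1) \<in> estimators n p" by (simp add: estimators_def)
  then show ?thesis by blast
qed

lemma bdd_above_risk:
  assumes "n > 0" "est \<in> estimators n p"
  shows "bdd_above ((\<lambda>(\<theta>, \<eta>). risk n p \<sigma> est \<theta> \<eta>) ` param_space n p \<Delta>)"
  using risk_bounds[OF assms] by (intro bdd_aboveI[of _ 2]) (auto simp: param_space_def)

lemma bdd_below_sup_risk:
  assumes "n > 0" "p > 0"
  shows "bdd_below ((\<lambda>est. SUP (\<theta>, \<eta>)\<in>param_space n p \<Delta>. risk n p \<sigma> est \<theta> \<eta>) ` estimators n p)"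
proof (intro bdd_belowI2[of _ 0])
  fix est assume est: "est \<in> estimators n p"
  obtain x where x: "x \<in> param_space n p \<Delta>" using param_space_nonempty[OF assms(2)] by blast
  then have "0 \<le> (\<lambda>(\<theta>, \<eta>). risk n p \<sigma> est \<theta> \<eta>) x"
    using risk_bounds(1)[OF assms(1) est] by (auto simp: param_space_def)
  also have "\<dots> \<le> (SUP (\<theta>, \<eta>)\<in>param_space n p \<Delta>. risk n p \<sigma> est \<theta> \<eta>)"
    by (rule cSUP_upper[OF x bdd_above_risk[OF assms(1) est]])
  finally show "0 \<le> (SUP (\<theta>, \<eta>)\<in>param_space n p \<Delta>. risk n p \<sigma> est \<theta> \<eta>)" .
qed

end

theory Submission
  imports Defs
begin

text \<open>
  The bound is a Bayesian one, with unit noise after rescaling. Put \<open>D = max (\<Delta>/\<sigma>) 1\<close> and let the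
  direction be \<open>u = D g / \<parallel>g\<parallel>\<close> for a standard Gaussian vector \<open>g\<close>, so that \<open>\<parallel>u\<parallel> = D\<close> holds almost
  surely, independent of labels \<open>\<eta>\<close> that are uniform on \<open>{-1,1}^n\<close>.

  The loss ignores a global sign, and so does the product of two labels: \<open>n\<close> times the loss is at least
  the number of ordered pairs \<open>(i, j)\<close> for which the estimate gets \<open>\<eta> i * \<eta> j\<close> wrong
  (\<open>loss_ge_misclassified_pairs\<close>). Hence it is enough to bound below, for each \<open>i \<noteq> j\<close>, the sum of the two
  errors when \<open>\<eta>\<close> is tested against the vector with \<open>\<eta> j\<close> negated. Such a pair of hypotheses has opposite
  products \<open>\<eta> i * \<eta> j\<close>.

  Relative to pure noise, the law of the data \<open>x\<close> given \<open>u\<close> and \<open>\<eta>\<close> has density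
  \<open>exp (\<langle>u, T\<rangle> - n \<parallel>u\<parallel>^2 / 2)\<close> with \<open>T = (\<Sum>k. \<eta> k * x k)\<close>. Averaged over the rotation invariant law of
  \<open>u\<close> it becomes an increasing function of \<open>\<parallel>T\<parallel>\<close> (\<open>spherical_mixture_density\<close>,
  \<open>spherical_likelihood_mono\<close>). With \<open>S = (\<Sum>k\<noteq>j. \<eta> k * x k)\<close>, the two hypotheses have
  \<open>T = S + \<eta> j * x j\<close> and \<open>T' = S - \<eta> j * x j\<close>. So the data favour the wrong one as soon as
  \<open>\<eta> j * \<langle>x j, S\<rangle> \<le> 0\<close>, and the sum of the two testing errors is at least the probability of this event
  under the true hypothesis (\<open>spherical_mixture_testing\<close>).

  That probability can be bounded for each fixed \<open>u\<close> (\<open>flip_alignment_probability\<close>). With \<open>m = n - 1\<close>, \<open>S\<close>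
  is distributed as \<open>m u + \<surd>m z\<close> for a standard Gaussian \<open>z\<close> independent of \<open>x j\<close>, and given \<open>S\<close> the event
  has probability \<open>P(N(0,1) \<ge> \<langle>u, S\<rangle> / \<parallel>S\<parallel>)\<close>. By Chebyshev's inequality, with probability at least \<open>1/2\<close>
  the vector \<open>z\<close> is nearly orthogonal to \<open>u\<close> and \<open>\<parallel>z\<parallel>^2\<close> is close to \<open>p\<close>. Then \<open>\<langle>u, S\<rangle>\<close> is about
  \<open>m D^2\<close> and \<open>\<parallel>S\<parallel>^2\<close> about \<open>m^2 (D^2 + p/m)\<close>, which gives the tail at \<open>D^2 / \<surd>(D^2 + p/n)\<close> up to a factor
  that tends to 1 at a rate free of \<open>p\<close>, \<open>\<sigma>\<close> and \<open>\<Delta>\<close>. Only constant probabilities are needed here, because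
  the prior lives on the sphere: with a Gaussian prior, the event that \<open>u\<close> is too short would have to be
  exponentially unlikely.

  Finally, \<open>D \<ge> 1\<close> is what makes the fluctuations relatively small. When \<open>\<Delta> < \<sigma>\<close>, the signal-to-noise
  ratio is below 1 and a constant lower bound is enough; it comes from the case \<open>D = 1\<close>.
\<close>

section \<open>Rotation invariance of Gaussian vectors\<close>

abbreviation std_normal :: "real measure" where "std_normal \<equiv> std_normal_distribution"

lemma prob_space_std_normal: "prob_space std_normal"
  by (rule prob_space_normal_density) simp

abbreviation std_normal_power :: "'i set \<Rightarrow> ('i \<Rightarrow> real) measure" where
  "std_normal_power I \<equiv> PiM I (\<lambda>_. std_normal)"

interpretation std_normal: prob_space std_normal
  by (rule prob_space_std_normal)

interpretation std_normal_power: product_prob_space "\<lambda>_. std_normal" I for I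
  by (rule product_prob_spaceI) (rule prob_space_std_normal)

text \<open>
  The joint density of two independent standard normals is a function of \<open>x^2 + y^2\<close>. When the integrand
  sees the pair only through one linear form and \<open>x^2 + y^2\<close>, the density can therefore be absorbed
  into the integrand, which leaves an integral against Lebesgue measure.
\<close>
lemma nn_integral_std_normal_pair:
  assumes [measurable]: "(\<lambda>(u, q). k u q) \<in> borel_measurable (borel \<Otimes>\<^sub>M borel)"
  shows "(\<integral>\<^sup>+x. (\<integral>\<^sup>+y. k (\<alpha> * x + \<beta> * y) (x\<^sup>2 + y\<^sup>2) \<partial>std_normal) \<partial>std_normal) =
    (\<integral>\<^sup>+x. (\<integral>\<^sup>+y. k (\<alpha> * x + \<beta> * y) (x\<^sup>2 + y\<^sup>2) * ennreal (exp (- (x\<^sup>2 + y\<^sup>2) / 2) / (2 * pi)) \<partial>lborel)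
        \<partial>lborel)"
proof -
  have eq: "ennreal (std_normal_density x) * (ennreal (std_normal_density y) * c) =
      c * ennreal (exp (- (x\<^sup>2 + y\<^sup>2) / 2) / (2 * pi))" for x y c
  proof -
    have "std_normal_density x * std_normal_density y = exp (- (x\<^sup>2 + y\<^sup>2) / 2) / (2 * pi)"
    proof -
      have "exp (- (x\<^sup>2 + y\<^sup>2) / 2) = exp (- x\<^sup>2 / 2) * exp (- y\<^sup>2 / 2)"
        by (subst exp_add[symmetric]) (simp add: field_simps)
      then show ?thesis by (simp add: std_normal_density_def)
    qed
    then have "ennreal (std_normal_density x) * ennreal (std_normal_density y) =
        ennreal (exp (- (x\<^sup>2 + y\<^sup>2) / 2) / (2 * pi))"
      by (subst ennreal_mult[symmetric]) simp_all
    then show ?thesis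
      by (simp only: mult.assoc[symmetric]) (simp only: mult.commute)
  qed
  have "(\<integral>\<^sup>+x. (\<integral>\<^sup>+y. k (\<alpha> * x + \<beta> * y) (x\<^sup>2 + y\<^sup>2) \<partial>std_normal) \<partial>std_normal) =
    (\<integral>\<^sup>+x. (\<integral>\<^sup>+y. ennreal (std_normal_density x) * (ennreal (std_normal_density y) * 
        k (\<alpha> * x + \<beta> * y) (x\<^sup>2 + y\<^sup>2)) \<partial>lborel) \<partial>lborel)"
    by (simp add: nn_integral_density nn_integral_cmult)
  then show ?thesis unfolding eq .
qed

text \<open>
  For a unit vector \<open>(\<alpha>, \<beta>)\<close>, the rotation is carried out as two affine substitutions in one variable:
  \<open>x\<close> is replaced by \<open>u = \<alpha> x + \<beta> y\<close> with \<open>y\<close> fixed, and then \<open>y\<close> by \<open>v = (y - \<beta> u) / \<alpha>\<close> with \<open>u\<close>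
  fixed. The factors \<open>1 / \<alpha>\<close> and \<open>\<alpha>\<close> cancel, and \<open>x^2 + y^2 = u^2 + v^2\<close>.
\<close>
lemma std_normal_planar_rotation_unit:
  assumes h[measurable]: "(\<lambda>(u, q). h u q) \<in> borel_measurable (borel \<Otimes>\<^sub>M borel)"
    and "\<alpha> > 0" and unit: "\<alpha>\<^sup>2 + \<beta>\<^sup>2 = 1"
  shows "(\<integral>\<^sup>+x. (\<integral>\<^sup>+y. h (\<alpha> * x + \<beta> * y) (x\<^sup>2 + y\<^sup>2) \<partial>std_normal) \<partial>std_normal) =
    (\<integral>\<^sup>+x. (\<integral>\<^sup>+y. h x (x\<^sup>2 + y\<^sup>2) \<partial>std_normal) \<partial>std_normal)"
proof -
  define k where "k u q = h u q * ennreal (exp (- q / 2) / (2 * pi))" for u q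
  have k[measurable]: "(\<lambda>(u, q). k u q) \<in> borel_measurable (borel \<Otimes>\<^sub>M borel)"
    unfolding k_def by measurable
  have q1: "(u / \<alpha> - \<beta> / \<alpha> * y)\<^sup>2 + y\<^sup>2 = u\<^sup>2 + ((y - \<beta> * u) / \<alpha>)\<^sup>2" for u y
  proof -
    have b: "\<beta>\<^sup>2 = 1 - \<alpha>\<^sup>2" using unit by simp
    \<comment> \<open>Here \<open>u / \<alpha> - \<beta> / \<alpha> * y\<close> is \<open>x\<close> expressed through \<open>u\<close> and \<open>y\<close>.\<close>
    have "\<alpha>\<^sup>2 * ((u / \<alpha> - \<beta> / \<alpha> * y)\<^sup>2 + y\<^sup>2) = (u - \<beta> * y)\<^sup>2 + \<alpha>\<^sup>2 * y\<^sup>2"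
      using \<open>\<alpha> > 0\<close> by (simp add: field_simps power2_eq_square)
    also have "\<dots> = \<alpha>\<^sup>2 * u\<^sup>2 + (y - \<beta> * u)\<^sup>2"
      by (simp add: power2_diff power_mult_distrib b) (simp add: algebra_simps)
    also have "\<dots> = \<alpha>\<^sup>2 * (u\<^sup>2 + ((y - \<beta> * u) / \<alpha>)\<^sup>2)"
      using \<open>\<alpha> > 0\<close> by (simp add: field_simps power2_eq_square)
    finally show ?thesis using \<open>\<alpha> > 0\<close> by simp
  qed
  have "(\<integral>\<^sup>+x. (\<integral>\<^sup>+y. h (\<alpha> * x + \<beta> * y) (x\<^sup>2 + y\<^sup>2) \<partial>std_normal) \<partial>std_normal) =
      (\<integral>\<^sup>+x. (\<integral>\<^sup>+y. k (\<alpha> * x + \<beta> * y) (x\<^sup>2 + y\<^sup>2) \<partial>lborel) \<partial>lborel)"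
    unfolding nn_integral_std_normal_pair[OF h] k_def ..
  also have "\<dots> = (\<integral>\<^sup>+y. (\<integral>\<^sup>+x. k (\<alpha> * x + \<beta> * y) (x\<^sup>2 + y\<^sup>2) \<partial>lborel) \<partial>lborel)"
    by (rule lborel_pair.Fubini') measurable
  also have "\<dots> = (\<integral>\<^sup>+y. ennreal (1 / \<alpha>) * (\<integral>\<^sup>+u. k u (u\<^sup>2 + ((y - \<beta> * u) / \<alpha>)\<^sup>2) \<partial>lborel) \<partial>lborel)"
  proof (rule nn_integral_cong)
    fix y :: real
    show "(\<integral>\<^sup>+x. k (\<alpha> * x + \<beta> * y) (x\<^sup>2 + y\<^sup>2) \<partial>lborel) =
       ennreal (1 / \<alpha>) * (\<integral>\<^sup>+u. k u (u\<^sup>2 + ((y - \<beta> * u) / \<alpha>)\<^sup>2) \<partial>lborel)"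
    proof -
      have "\<alpha> * (- (\<beta> / \<alpha> * y) + 1 / \<alpha> * u) + \<beta> * y = u"
        "- (\<beta> / \<alpha> * y) + 1 / \<alpha> * u = u / \<alpha> - \<beta> / \<alpha> * y" for u
        using \<open>\<alpha> > 0\<close> by (simp_all add: field_simps)
      note * = this(1) this(2)[THEN arg_cong[where f="\<lambda>x. x\<^sup>2 + y\<^sup>2"], unfolded q1]
      show ?thesis
        using \<open>\<alpha> > 0\<close> nn_integral_real_affine[where c="1 / \<alpha>" and t="- (\<beta> / \<alpha> * y)"
            and f="\<lambda>x. k (\<alpha> * x + \<beta> * y) (x\<^sup>2 + y\<^sup>2)"]
        unfolding * by simp
    qed
  qed
  also have "\<dots> = (\<integral>\<^sup>+u. ennreal (1 / \<alpha>) * (\<integral>\<^sup>+y. k u (u\<^sup>2 + ((y - \<beta> * u) / \<alpha>)\<^sup>2) \<partial>lborel) \<partial>lborel)"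
    by (subst nn_integral_cmult, measurable)+
        (intro arg_cong2[where f="(*)"] refl lborel_pair.Fubini', measurable)
  also have "\<dots> = (\<integral>\<^sup>+u. (\<integral>\<^sup>+v. k u (u\<^sup>2 + v\<^sup>2) \<partial>lborel) \<partial>lborel)"
  proof (rule nn_integral_cong)
    fix u :: real
    show "ennreal (1 / \<alpha>) * (\<integral>\<^sup>+y. k u (u\<^sup>2 + ((y - \<beta> * u) / \<alpha>)\<^sup>2) \<partial>lborel) = (\<integral>\<^sup>+v. k u (u\<^sup>2 + v\<^sup>2)
        \<partial>lborel)"
      using \<open>\<alpha> > 0\<close>
      by (subst nn_integral_real_affine[where c="\<alpha>" and t="\<beta> * u"])
         (simp_all add: mult.assoc[symmetric] ennreal_mult'[symmetric])
  qed
  also have "\<dots> = (\<integral>\<^sup>+x. (\<integral>\<^sup>+y. h x (x\<^sup>2 + y\<^sup>2) \<partial>std_normal) \<partial>std_normal)"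
    using nn_integral_std_normal_pair[OF h, of 1 0] by (simp add: k_def)
  finally show ?thesis .
qed

lemma nn_integral_std_normal_minus:
  assumes [measurable]: "f \<in> borel_measurable borel"
  shows "(\<integral>\<^sup>+x. f (- x) \<partial>std_normal) = (\<integral>\<^sup>+x. f x \<partial>std_normal)"
proof -
  have "(\<integral>\<^sup>+x. ennreal (std_normal_density x) * f x \<partial>lborel) =
      (\<integral>\<^sup>+x. ennreal (std_normal_density x) * f (- x) \<partial>lborel)"
    using nn_integral_real_affine[where c="-1" and t=0 and f="\<lambda>x. ennreal (std_normal_density x) * f x"]
    by (simp add: std_normal_density_def)
  then show ?thesis by (simp add: nn_integral_density)
qed

text \<open>
  The general case follows by scaling to a unit vector. For \<open>\<alpha> = 0\<close>, where the substitution above breaks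
  down, exchanging the coordinates and reflecting the first one gives the claim.
\<close>
lemma std_normal_planar_rotation:
  assumes h[measurable]: "(\<lambda>(u, q). h u q) \<in> borel_measurable (borel \<Otimes>\<^sub>M borel)"
    and "\<alpha> \<ge> 0"
  shows "(\<integral>\<^sup>+x. (\<integral>\<^sup>+y. h (\<alpha> * x + \<beta> * y) (x\<^sup>2 + y\<^sup>2) \<partial>std_normal) \<partial>std_normal) =
    (\<integral>\<^sup>+x. (\<integral>\<^sup>+y. h (sqrt (\<alpha>\<^sup>2 + \<beta>\<^sup>2) * x) (x\<^sup>2 + y\<^sup>2) \<partial>std_normal) \<partial>std_normal)"
proof (cases "\<alpha> = 0")
  case True
  interpret pair_sigma_finite std_normal std_normal ..
  have "(\<integral>\<^sup>+x. (\<integral>\<^sup>+y. h (\<beta> * y) (x\<^sup>2 + y\<^sup>2) \<partial>std_normal) \<partial>std_normal) =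
    (\<integral>\<^sup>+y. (\<integral>\<^sup>+x. h (\<beta> * y) (x\<^sup>2 + y\<^sup>2) \<partial>std_normal) \<partial>std_normal)"
    by (rule Fubini') measurable
  also have "\<dots> = (\<integral>\<^sup>+y. (\<integral>\<^sup>+x. h (\<bar>\<beta>\<bar> * y) (y\<^sup>2 + x\<^sup>2) \<partial>std_normal) \<partial>std_normal)"
  proof (cases "\<beta> \<ge> 0")
    case False
    then show ?thesis
      using nn_integral_std_normal_minus[of "\<lambda>y. \<integral>\<^sup>+x. h (\<beta> * y) (x\<^sup>2 + y\<^sup>2) \<partial>std_normal"]
      by (simp add: add.commute)
  qed (simp add: add.commute)
  finally show ?thesis using True by simp
next
  case False
  define r where "r = sqrt (\<alpha>\<^sup>2 + \<beta>\<^sup>2)"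
  have r: "r > 0" using False by (simp add: r_def sum_power2_gt_zero_iff)
  have "(\<lambda>(u, q). h (r * u) q) \<in> borel_measurable (borel \<Otimes>\<^sub>M borel)" by measurable
  moreover have "(\<alpha> / r)\<^sup>2 + (\<beta> / r)\<^sup>2 = 1"
    using r by (simp add: power_divide add_divide_distrib[symmetric]) (simp add: r_def)
  ultimately have "(\<integral>\<^sup>+x. (\<integral>\<^sup>+y. h (r * (\<alpha> / r * x + \<beta> / r * y)) (x\<^sup>2 + y\<^sup>2) \<partial>std_normal) \<partial>std_normal) =
    (\<integral>\<^sup>+x. (\<integral>\<^sup>+y. h (r * x) (x\<^sup>2 + y\<^sup>2) \<partial>std_normal) \<partial>std_normal)"
    using r False assms(2) by (intro std_normal_planar_rotation_unit) auto
  then show ?thesis using r by (simp add: distrib_left r_def[symmetric])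
qed

text \<open>
  Coordinates are added one at a time. The induction hypothesis aligns the form on the old coordinates
  with coordinate \<open>i\<close>, and a rotation in the plane of \<open>i\<close> and the new coordinate absorbs the rest. The other
  coordinates enter only as a shift of the squared norm, which is why \<open>h\<close> must be arbitrary.
\<close>
lemma std_normal_power_rotation_insert:
  assumes "finite J" "i \<notin> J"
    and "(\<lambda>(u, q). h u q) \<in> borel_measurable (borel \<Otimes>\<^sub>M borel)"
  shows "(\<integral>\<^sup>+g. h (\<Sum>l\<in>insert i J. g l * T l) (\<Sum>l\<in>insert i J. (g l)\<^sup>2) \<partial>std_normal_power (insert i J)) =
    (\<integral>\<^sup>+g. h (L2_set T (insert i J) * g i) (\<Sum>l\<in>insert i J. (g l)\<^sup>2) \<partial>std_normal_power (insert i J))"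
  using assms
proof (induction J arbitrary: h rule: finite_induct)
  case empty
  note [measurable] = empty.prems(2)
  have "(\<integral>\<^sup>+y. h (y * T i) (y\<^sup>2) \<partial>std_normal) = (\<integral>\<^sup>+y. h (\<bar>T i\<bar> * y) (y\<^sup>2) \<partial>std_normal)"
  proof (cases "T i \<ge> 0")
    case False
    have "(\<integral>\<^sup>+y. h (- y * T i) ((- y)\<^sup>2) \<partial>std_normal) = (\<integral>\<^sup>+y. h (y * T i) (y\<^sup>2) \<partial>std_normal)"
      by (rule nn_integral_std_normal_minus) measurable
    then show ?thesis using False by (simp add: mult.commute[of "T i"])
  qed (simp add: mult.commute[of "T i"])
  moreover have "(\<integral>\<^sup>+g. h (g i * T i) ((g i)\<^sup>2) \<partial>std_normal_power {i}) = (\<integral>\<^sup>+y. h (y * T i) (y\<^sup>2)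
      \<partial>std_normal)"
    by (rule std_normal_power.product_nn_integral_singleton) measurable
  moreover have "(\<integral>\<^sup>+g. h (\<bar>T i\<bar> * g i) ((g i)\<^sup>2) \<partial>std_normal_power {i}) = (\<integral>\<^sup>+y. h (\<bar>T i\<bar> * y) (y\<^sup>2)
      \<partial>std_normal)"
    by (rule std_normal_power.product_nn_integral_singleton) measurable
  ultimately show ?case by simp
next
  case (insert k J)
  note [measurable] = insert.prems(2)
  have fin: "finite (insert i J)" and k: "k \<notin> insert i J" and i: "i \<notin> J" "k \<noteq> i"
    using insert.hyps insert.prems by auto
  interpret J: prob_space "std_normal_power J"
    by (intro prob_space_PiM prob_space_std_normal)
  interpret iJ: prob_space "std_normal_power (insert i J)"
    by (intro prob_space_PiM prob_space_std_normal)
  interpret P: pair_sigma_finite "std_normal_power (insert i J)" std_normal ..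
  define R where "R = L2_set T (insert i J)"
  have comm: "insert i (insert k J) = insert k (insert i J)" by auto
  have upd: "(\<Sum>l\<in>insert k (insert i J). (x(k := y)) l * T l) = (\<Sum>l\<in>insert i J. x l * T l) + y * T k"
      "(\<Sum>l\<in>insert k (insert i J). ((x(k := y)) l)\<^sup>2) = (\<Sum>l\<in>insert i J. (x l)\<^sup>2) + y\<^sup>2" 
      for x :: "'a \<Rightarrow> real" and y
  proof -
    have "(\<Sum>l\<in>insert i J. f ((x(k := y)) l) l) = (\<Sum>l\<in>insert i J. f (x l) l)" for f :: "real \<Rightarrow> 'a \<Rightarrow> real"
      using k by (intro sum.cong) auto
    from this[of "\<lambda>x l. x * T l"] this[of "\<lambda>x l. x\<^sup>2"]
    show "(\<Sum>l\<in>insert k (insert i J). (x(k := y)) l * T l) = (\<Sum>l\<in>insert i J. x l * T l) + y * T k"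
      "(\<Sum>l\<in>insert k (insert i J). ((x(k := y)) l)\<^sup>2) = (\<Sum>l\<in>insert i J. (x l)\<^sup>2) + y\<^sup>2"
      using k fin by (simp_all add: add.commute)
  qed
  have upd2: "(\<Sum>l\<in>insert i J. ((x(i := z)) l)\<^sup>2) = (\<Sum>l\<in>J. (x l)\<^sup>2) + z\<^sup>2" for x :: "'a \<Rightarrow> real" and z
  proof -
    have "(\<Sum>l\<in>J. ((x(i := z)) l)\<^sup>2) = (\<Sum>l\<in>J. (x l)\<^sup>2)" using i by (intro sum.cong) auto
    then show ?thesis using i insert.hyps by (simp add: add.commute)
  qed
  have RR: "R \<ge> 0" "sqrt (R\<^sup>2 + (T k)\<^sup>2) = L2_set T (insert k (insert i J))"
    using k fin insert.hyps by (simp_all add: R_def L2_set_def add.commute sum_nonneg)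
  have "(\<integral>\<^sup>+g. h (\<Sum>l\<in>insert k (insert i J). g l * T l) (\<Sum>l\<in>insert k (insert i J). (g l)\<^sup>2)
      \<partial>std_normal_power (insert k (insert i J))) =
    (\<integral>\<^sup>+y. \<integral>\<^sup>+x. h ((\<Sum>l\<in>insert i J. x l * T l) + y * T k) ((\<Sum>l\<in>insert i J. (x l)\<^sup>2) + y\<^sup>2)
       \<partial>std_normal_power (insert i J) \<partial>std_normal)"
    unfolding upd[symmetric] using fin k by
        (intro std_normal_power.product_nn_integral_insert_rev) measurable
  also have "\<dots> = (\<integral>\<^sup>+y. \<integral>\<^sup>+x. h (R * x i + y * T k) ((\<Sum>l\<in>insert i J. (x l)\<^sup>2) + y\<^sup>2)
       \<partial>std_normal_power (insert i J) \<partial>std_normal)"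
    unfolding R_def by (intro nn_integral_cong insert.IH[where h="\<lambda>u q. h (u + y * T k) (q + y\<^sup>2)"
        for y] i) measurable
  also have "\<dots> = (\<integral>\<^sup>+x. \<integral>\<^sup>+y. h (R * x i + y * T k) ((\<Sum>l\<in>insert i J. (x l)\<^sup>2) + y\<^sup>2)
       \<partial>std_normal \<partial>std_normal_power (insert i J))"
    by (rule P.Fubini') measurable
  also have "\<dots> = (\<integral>\<^sup>+x. \<integral>\<^sup>+z. \<integral>\<^sup>+y. h (R * z + T k * y) ((z\<^sup>2 + y\<^sup>2) + (\<Sum>l\<in>J. (x l)\<^sup>2))
       \<partial>std_normal \<partial>std_normal \<partial>std_normal_power J)"
    using i insert.hyps 
    by (subst std_normal_power.product_nn_integral_insert)
       (simp_all add: upd2 add.commute add.left_commute mult.commute fun_upd_same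
           del: sum.insert fun_upd_apply)
  also have "\<dots> = (\<integral>\<^sup>+x. \<integral>\<^sup>+z. \<integral>\<^sup>+y. h (L2_set T (insert k (insert i J)) * z) ((z\<^sup>2 + y\<^sup>2) + (\<Sum>l\<in>J. (x l)\<^sup>2))
       \<partial>std_normal \<partial>std_normal \<partial>std_normal_power J)"
    unfolding RR(2)[symmetric]
    by (intro nn_integral_cong std_normal_planar_rotation[where h="\<lambda>u q. h u (q + (\<Sum>l\<in>J. (x l)\<^sup>2))"
        for x] RR) measurable
  also have "\<dots> = (\<integral>\<^sup>+x. \<integral>\<^sup>+y. h (L2_set T (insert k (insert i J)) * x i) ((\<Sum>l\<in>insert i J. (x l)\<^sup>2) + y\<^sup>2)
       \<partial>std_normal \<partial>std_normal_power (insert i J))"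
    using i insert.hyps 
    by (subst std_normal_power.product_nn_integral_insert)
       (simp_all add: upd2 add.commute add.left_commute mult.commute fun_upd_same
           del: sum.insert fun_upd_apply)
  also have "\<dots> = (\<integral>\<^sup>+g. h (L2_set T (insert k (insert i J)) * g i) (\<Sum>l\<in>insert k (insert i J). (g l)\<^sup>2)
      \<partial>std_normal_power (insert k (insert i J)))"
    using fin k i by (subst std_normal_power.product_nn_integral_insert)
        (simp_all only: upd fun_upd_other[OF i(2)[symmetric]] finite_insert, measurable)
  finally show ?case unfolding comm .
qed

text \<open>
  This is what turns the average of a likelihood over the prior into a function of \<open>\<parallel>T\<parallel>\<close> alone.
\<close>
lemma std_normal_power_rotation:
  assumes "finite I" "i \<in> I"
    and "(\<lambda>(u, q). h u q) \<in> borel_measurable (borel \<Otimes>\<^sub>M borel)"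
  shows "(\<integral>\<^sup>+g. h (\<Sum>l\<in>I. g l * T l) (\<Sum>l\<in>I. (g l)\<^sup>2) \<partial>std_normal_power I) =
    (\<integral>\<^sup>+g. h (L2_set T I * g i) (\<Sum>l\<in>I. (g l)\<^sup>2) \<partial>std_normal_power I)"
  using std_normal_power_rotation_insert[of "I - {i}" i h T] assms unfolding insert_Diff[OF assms(2)]
      by blast

section \<open>Linear images of Gaussian vectors and matrices\<close>

lemma prob_space_std_normal_power: "prob_space (std_normal_power I)"
  by (intro prob_space_PiM prob_space_std_normal)

interpretation std_normal_matrix: product_prob_space "\<lambda>_. std_normal_power L" K for K L
  by (rule product_prob_spaceI) (rule prob_space_std_normal_power)

lemma nn_integral_std_normal_power_linear:
  assumes "finite I" "i \<in> I" and [measurable]: "f \<in> borel_measurable borel"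
  shows "(\<integral>\<^sup>+g. f (\<Sum>l\<in>I. g l * T l) \<partial>std_normal_power I) = (\<integral>\<^sup>+x. f (L2_set T I * x) \<partial>std_normal)"
proof -
  have "(\<integral>\<^sup>+g. f (\<Sum>l\<in>I. g l * T l) \<partial>std_normal_power I) =
      (\<integral>\<^sup>+g. f (L2_set T I * g i) \<partial>std_normal_power I)"
    using assms by (intro std_normal_power_rotation[where h="\<lambda>u q. f u"]) measurable
  also have "\<dots> = (\<integral>\<^sup>+x. f (L2_set T I * x) \<partial>distr (std_normal_power I) std_normal (\<lambda>g. g i))"
    using assms(2) by (subst nn_integral_distr) auto
  also have "distr (std_normal_power I) std_normal (\<lambda>g. g i) = std_normal"
    using assms(2) by (intro distr_PiM_component prob_space_std_normal) auto
  finally show ?thesis .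
qed

text \<open>
  The variances of independent centred normals add up: the planar rotation, applied to a function that
  does not depend on \<open>x^2 + y^2\<close>.
\<close>
lemma std_normal_convolution:
  assumes [measurable]: "f \<in> borel_measurable borel" and "a \<ge> 0"
  shows "(\<integral>\<^sup>+x. \<integral>\<^sup>+y. f (a * x + b * y) \<partial>std_normal \<partial>std_normal) =
    (\<integral>\<^sup>+x. f (sqrt (a\<^sup>2 + b\<^sup>2) * x) \<partial>std_normal)"
proof -
  have "(\<integral>\<^sup>+x. \<integral>\<^sup>+y. f (a * x + b * y) \<partial>std_normal \<partial>std_normal) =
    (\<integral>\<^sup>+x. \<integral>\<^sup>+y. f (sqrt (a\<^sup>2 + b\<^sup>2) * x) \<partial>std_normal \<partial>std_normal)"
    by (intro std_normal_planar_rotation[where h="\<lambda>u q. f u"] assms(2)) measurable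
  also have "\<dots> = (\<integral>\<^sup>+x. f (sqrt (a\<^sup>2 + b\<^sup>2) * x) \<partial>std_normal)"
    by (simp only: nn_integral_const std_normal.emeasure_space_1 mult_1_right)
  finally show ?thesis .
qed

lemma emeasure_distr_nn_integral:
  assumes "f \<in> M \<rightarrow>\<^sub>M N" "A \<in> sets N"
  shows "emeasure (distr M N f) A = (\<integral>\<^sup>+x. indicator A (f x) \<partial>M)"
proof -
  have "emeasure (distr M N f) A = (\<integral>\<^sup>+y. indicator A y \<partial>distr M N f)"
    using assms by (intro nn_integral_indicator[symmetric]) simp
  also have "\<dots> = (\<integral>\<^sup>+x. indicator A (f x) \<partial>M)"
    using assms by (intro nn_integral_distr) auto
  finally show ?thesis .
qed

lemma indicator_PiE_prod:
  assumes "finite L" "x \<in> extensional L"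
  shows "(indicator (PiE L A) x :: ennreal) = (\<Prod>l\<in>L. indicator (A l) (x l))"
proof (cases "\<forall>l\<in>L. x l \<in> A l")
  case True
  then show ?thesis using assms by (auto simp: PiE_def)
next
  case False
  then obtain l where "l \<in> L" "x l \<notin> A l" by auto
  then have "x \<notin> PiE L A" "\<exists>l\<in>L. indicator (A l) (x l) = (0 :: ennreal)"
    by (auto intro!: bexI[of _ l])
  then show ?thesis using assms(1) by (simp add: prod_zero)
qed

text \<open>
  The vector version of the previous lemma. Both sides are integrals against measures on a product space,
  and these measures agree on boxes, where everything factorises over the coordinates.
\<close>
lemma std_normal_power_convolution:
  assumes "finite L" and H: "H \<in> borel_measurable (PiM L (\<lambda>_. borel))" and "a \<ge> 0"
  shows "(\<integral>\<^sup>+z. \<integral>\<^sup>+x. H (\<lambda>l\<in>L. a * z l + b * x l) \<partial>std_normal_power L \<partial>std_normal_power L) =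
    (\<integral>\<^sup>+z. H (\<lambda>l\<in>L. sqrt (a\<^sup>2 + b\<^sup>2) * z l) \<partial>std_normal_power L)"
proof -
  note [measurable] = H
  define \<gamma> where "\<gamma> = std_normal_power L"
  have [measurable_cong, simp]: "sets \<gamma> = sets (PiM L (\<lambda>_. borel :: real measure))"
    unfolding \<gamma>_def by (intro sets_PiM_cong) auto
  interpret \<gamma>: prob_space \<gamma> unfolding \<gamma>_def by (rule prob_space_std_normal_power)
  interpret P: pair_sigma_finite \<gamma> \<gamma> ..
  define s where "s = sqrt (a\<^sup>2 + b\<^sup>2)"
  define M where "M = distr std_normal borel (\<lambda>x. s * x)"
  interpret M: prob_space M unfolding M_def by (rule std_normal.prob_space_distr) measurable
  interpret PM: product_prob_space "\<lambda>_. M" L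
    by (rule product_prob_spaceI) (rule M.prob_space_axioms)
  have [simp]: "sets (PiM L (\<lambda>_. M)) = sets (PiM L (\<lambda>_. borel :: real measure))"
    by (intro sets_PiM_cong) (auto simp: M_def)
  have [measurable]: "(\<lambda>(z, x). \<lambda>l\<in>L. a * z l + b * x l) \<in> \<gamma> \<Otimes>\<^sub>M \<gamma> \<rightarrow>\<^sub>M PiM L (\<lambda>_. borel)"
    "(\<lambda>z. \<lambda>l\<in>L. s * z l) \<in> \<gamma> \<rightarrow>\<^sub>M PiM L (\<lambda>_. borel)"
    unfolding case_prod_beta by measurable
  have "distr (\<gamma> \<Otimes>\<^sub>M \<gamma>) (PiM L (\<lambda>_. borel)) (\<lambda>(z, x). \<lambda>l\<in>L. a * z l + b * x l) = PiM L (\<lambda>_. M)"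
  proof (rule PM.PiM_eqI)
    fix A :: "'a \<Rightarrow> real set" assume "\<And>l. l \<in> L \<Longrightarrow> A l \<in> sets M"
    then have A[measurable]: "\<And>l. l \<in> L \<Longrightarrow> A l \<in> sets borel" by (simp add: M_def)
    have A': "PiE L A \<in> sets (PiM L (\<lambda>_. borel))"
      using A assms(1) by (intro sets_PiM_I_finite) auto
    have "emeasure (distr (\<gamma> \<Otimes>\<^sub>M \<gamma>) (PiM L (\<lambda>_. borel)) (\<lambda>(z, x). \<lambda>l\<in>L. a * z l + b * x l)) (PiE L A) =
      (\<integral>\<^sup>+zx. indicator (PiE L A) ((\<lambda>(z, x). \<lambda>l\<in>L. a * z l + b * x l) zx) \<partial>(\<gamma> \<Otimes>\<^sub>M \<gamma>))"
      using A' by (intro emeasure_distr_nn_integral) simp_all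
    also have "\<dots> = (\<integral>\<^sup>+z. \<integral>\<^sup>+x. indicator (PiE L A) (\<lambda>l\<in>L. a * z l + b * x l) \<partial>\<gamma> \<partial>\<gamma>)"
      using A' by (subst \<gamma>.nn_integral_fst[symmetric]) auto
    also have "\<dots> = (\<integral>\<^sup>+z. \<integral>\<^sup>+x. (\<Prod>l\<in>L. indicator (A l) (a * z l + b * x l)) \<partial>\<gamma> \<partial>\<gamma>)"
      using assms(1) by (intro nn_integral_cong) (subst indicator_PiE_prod, auto intro!: prod.cong)
    also have "\<dots> = (\<integral>\<^sup>+z. (\<Prod>l\<in>L. \<integral>\<^sup>+x. indicator (A l) (a * z l + b * x) \<partial>std_normal) \<partial>\<gamma>)"
      unfolding \<gamma>_def using assms(1)
      by (intro nn_integral_cong std_normal_power.product_nn_integral_prod) auto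
    also have "\<dots> = (\<Prod>l\<in>L. \<integral>\<^sup>+z. \<integral>\<^sup>+x. indicator (A l) (a * z + b * x) \<partial>std_normal \<partial>std_normal)"
      unfolding \<gamma>_def using assms(1)
      by (intro std_normal_power.product_nn_integral_prod) auto
    also have "\<dots> = (\<Prod>l\<in>L. \<integral>\<^sup>+z. indicator (A l) (s * z) \<partial>std_normal)"
      unfolding s_def using assms(3) by (intro prod.cong std_normal_convolution) auto
    also have "\<dots> = (\<Prod>l\<in>L. emeasure M (A l))"
    proof (rule prod.cong)
      fix l assume "l \<in> L"
      then have Al: "A l \<in> sets borel" by (rule A)
      show "(\<integral>\<^sup>+z. indicator (A l) (s * z) \<partial>std_normal) = emeasure M (A l)"
        unfolding M_def by (intro emeasure_distr_nn_integral[symmetric] Al) simp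
    qed simp
    finally show "emeasure (distr (\<gamma> \<Otimes>\<^sub>M \<gamma>) (PiM L (\<lambda>_. borel)) (\<lambda>(z, x). \<lambda>l\<in>L. a * z l + b
        * x l)) (PiE L A) =
      (\<Prod>l\<in>L. emeasure M (A l))" .
  qed (use assms in auto)
  moreover have "distr \<gamma> (PiM L (\<lambda>_. borel)) (\<lambda>z. \<lambda>l\<in>L. s * z l) = PiM L (\<lambda>_. M)"
  proof (rule PM.PiM_eqI)
    fix A :: "'a \<Rightarrow> real set" assume "\<And>l. l \<in> L \<Longrightarrow> A l \<in> sets M"
    then have A[measurable]: "\<And>l. l \<in> L \<Longrightarrow> A l \<in> sets borel" by (simp add: M_def)
    have A': "PiE L A \<in> sets (PiM L (\<lambda>_. borel))"
      using A assms(1) by (intro sets_PiM_I_finite) auto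
    have "emeasure (distr \<gamma> (PiM L (\<lambda>_. borel)) (\<lambda>z. \<lambda>l\<in>L. s * z l)) (PiE L A) =
      (\<integral>\<^sup>+z. indicator (PiE L A) (\<lambda>l\<in>L. s * z l) \<partial>\<gamma>)"
      using A' by (intro emeasure_distr_nn_integral) simp_all
    also have "\<dots> = (\<integral>\<^sup>+z. (\<Prod>l\<in>L. indicator (A l) (s * z l)) \<partial>\<gamma>)"
      using assms(1) by (intro nn_integral_cong) (subst indicator_PiE_prod, auto intro!: prod.cong)
    also have "\<dots> = (\<Prod>l\<in>L. \<integral>\<^sup>+z. indicator (A l) (s * z) \<partial>std_normal)"
      unfolding \<gamma>_def using assms(1)
      by (intro std_normal_power.product_nn_integral_prod) auto
    also have "\<dots> = (\<Prod>l\<in>L. emeasure M (A l))"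
    proof (rule prod.cong)
      fix l assume "l \<in> L"
      then have Al: "A l \<in> sets borel" by (rule A)
      show "(\<integral>\<^sup>+z. indicator (A l) (s * z) \<partial>std_normal) = emeasure M (A l)"
        unfolding M_def by (intro emeasure_distr_nn_integral[symmetric] Al) simp
    qed simp
    finally show "emeasure (distr \<gamma> (PiM L (\<lambda>_. borel)) (\<lambda>z. \<lambda>l\<in>L. s * z l)) (PiE L A) =
      (\<Prod>l\<in>L. emeasure M (A l))" .
  qed (use assms in auto)
  ultimately have eq: "distr (\<gamma> \<Otimes>\<^sub>M \<gamma>) (PiM L (\<lambda>_. borel)) (\<lambda>(z, x). \<lambda>l\<in>L. a * z l + b * x l) =
      distr \<gamma> (PiM L (\<lambda>_. borel)) (\<lambda>z. \<lambda>l\<in>L. s * z l)" by simp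
  have "(\<integral>\<^sup>+z. \<integral>\<^sup>+x. H (\<lambda>l\<in>L. a * z l + b * x l) \<partial>\<gamma> \<partial>\<gamma>) =
     integral\<^sup>N (distr (\<gamma> \<Otimes>\<^sub>M \<gamma>) (PiM L (\<lambda>_. borel)) (\<lambda>(z, x). \<lambda>l\<in>L. a * z l + b * x l)) H"
    by (subst nn_integral_distr, measurable) (simp add: \<gamma>.nn_integral_fst[symmetric])
  also have "\<dots> = (\<integral>\<^sup>+z. H (\<lambda>l\<in>L. s * z l) \<partial>\<gamma>)"
    unfolding eq by (rule nn_integral_distr) measurable
  finally show ?thesis unfolding s_def \<gamma>_def .
qed

text \<open>
  One convolution for each vector that is added. The lemma will be applied to the noise in
  \<open>\<Sum>k\<noteq>j. \<eta> k * x k\<close>, where the coefficients are signs and the factor is \<open>\<surd>(n - 1)\<close>.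
\<close>
lemma std_normal_matrix_combination:
  fixes c :: "'k \<Rightarrow> real"
  assumes "finite K" "finite L" and H: "H \<in> borel_measurable (PiM L (\<lambda>_. borel))"
  shows "(\<integral>\<^sup>+\<xi>. H (\<lambda>l\<in>L. \<Sum>k\<in>K. c k * \<xi> k l) \<partial>PiM K (\<lambda>_. std_normal_power L)) =
    (\<integral>\<^sup>+z. H (\<lambda>l\<in>L. L2_set c K * z l) \<partial>std_normal_power L)"
  using assms(1) H
proof (induction K arbitrary: H rule: finite_induct)
  case empty
  show ?case
    by (simp only: L2_set_empty sum.empty mult_zero_left nn_integral_const
        std_normal_matrix.emeasure_space_1 prob_space.emeasure_space_1[OF prob_space_std_normal_power])
next
  case (insert k K)
  note [measurable] = insert.prems
  define \<gamma> where "\<gamma> = std_normal_power L"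
  have [measurable_cong, simp]: "sets \<gamma> = sets (PiM L (\<lambda>_. borel :: real measure))"
    unfolding \<gamma>_def by (intro sets_PiM_cong) auto
  interpret \<gamma>: prob_space \<gamma> unfolding \<gamma>_def by (rule prob_space_std_normal_power)
  interpret P: pair_sigma_finite \<gamma> \<gamma> ..
  have comp: "(\<lambda>\<xi>. \<xi> i l) \<in> borel_measurable (PiM K (\<lambda>_. \<gamma>))" if "i \<in> K" "l \<in> L" for i l and K :: "'k set"
  proof -
    have "(\<lambda>\<xi>. \<xi> i) \<in> PiM K (\<lambda>_. \<gamma>) \<rightarrow>\<^sub>M \<gamma>" using that by measurable
    moreover have "(\<lambda>x. x l) \<in> borel_measurable \<gamma>" using that by measurable
    ultimately show ?thesis by (rule measurable_compose)
  qed
  have m1: "(\<lambda>\<xi>. H (\<lambda>l\<in>L. \<Sum>k\<in>insert k K. c k * \<xi> k l)) \<in> borel_measurable (PiM (insert k K) (\<lambda>_. \<gamma>))"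
    by (rule measurable_compose[OF _ insert.prems], intro measurable_restrict borel_measurable_sum
        borel_measurable_times comp) auto
  have upd: "(\<Sum>i\<in>insert k K. c i * ((\<xi>(k := x)) i l)) = (\<Sum>i\<in>K. c i * \<xi> i l) + c k * x l" for \<xi> x l
  proof -
    have "(\<Sum>i\<in>K. c i * ((\<xi>(k := x)) i l)) = (\<Sum>i\<in>K. c i * \<xi> i l)"
      using insert.hyps by (intro sum.cong) auto
    then show ?thesis using insert.hyps by simp
  qed
  have "(\<integral>\<^sup>+\<xi>. H (\<lambda>l\<in>L. \<Sum>k\<in>insert k K. c k * \<xi> k l) \<partial>PiM (insert k K) (\<lambda>_. \<gamma>)) =
     (\<integral>\<^sup>+x. \<integral>\<^sup>+\<xi>. H (\<lambda>l\<in>L. (\<Sum>i\<in>K. c i * \<xi> i l) + c k * x l) \<partial>PiM K (\<lambda>_. \<gamma>) \<partial>\<gamma>)"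
    using m1 unfolding upd[symmetric] \<gamma>_def
    by (intro std_normal_matrix.product_nn_integral_insert_rev insert.hyps)
  also have "\<dots> = (\<integral>\<^sup>+x. \<integral>\<^sup>+z. H (\<lambda>l\<in>L. L2_set c K * z l + c k * x l) \<partial>\<gamma> \<partial>\<gamma>)"
  proof (rule nn_integral_cong)
    fix x assume "x \<in> space \<gamma>"
    have "(\<integral>\<^sup>+\<xi>. H (\<lambda>l\<in>L. (\<lambda>l\<in>L. \<Sum>i\<in>K. c i * \<xi> i l) l + c k * x l) \<partial>PiM K (\<lambda>_. \<gamma>)) =
      (\<integral>\<^sup>+z. H (\<lambda>l\<in>L. (\<lambda>l\<in>L. L2_set c K * z l) l + c k * x l) \<partial>\<gamma>)"
      unfolding \<gamma>_def by (rule insert.IH) measurable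
    then show "(\<integral>\<^sup>+\<xi>. H (\<lambda>l\<in>L. (\<Sum>i\<in>K. c i * \<xi> i l) + c k * x l) \<partial>PiM K (\<lambda>_. \<gamma>)) =
      (\<integral>\<^sup>+z. H (\<lambda>l\<in>L. L2_set c K * z l + c k * x l) \<partial>\<gamma>)" by (simp cong: restrict_cong)
  qed
  also have "\<dots> = (\<integral>\<^sup>+z. \<integral>\<^sup>+x. H (\<lambda>l\<in>L. L2_set c K * z l + c k * x l) \<partial>\<gamma> \<partial>\<gamma>)"
    by (rule P.Fubini') measurable
  also have "\<dots> = (\<integral>\<^sup>+z. H (\<lambda>l\<in>L. sqrt ((L2_set c K)\<^sup>2 + (c k)\<^sup>2) * z l) \<partial>\<gamma>)"
    unfolding \<gamma>_def by (intro std_normal_power_convolution assms(2) insert.prems) simp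
  also have "sqrt ((L2_set c K)\<^sup>2 + (c k)\<^sup>2) = L2_set c (insert k K)"
    using insert.hyps by (simp add: add.commute)
  finally show ?case unfolding \<gamma>_def .
qed

section \<open>Concentration of a Gaussian vector\<close>

lemma std_normal_moments:
  "has_bochner_integral std_normal (\<lambda>x. x\<^sup>2) 1" "has_bochner_integral std_normal (\<lambda>x. x ^ 4) 3"
proof -
  have "has_bochner_integral lborel (\<lambda>x. std_normal_density x *\<^sub>R x\<^sup>2) 1"
    using std_normal_moment_even[of 1] by (simp add: fact_numeral)
  then show "has_bochner_integral std_normal (\<lambda>x. x\<^sup>2) 1"
    by (rule has_bochner_integral_density[rotated -1]) auto
  have "has_bochner_integral lborel (\<lambda>x. std_normal_density x *\<^sub>R x ^ 4) 3"
    using std_normal_moment_even[of 2] by (simp add: fact_numeral)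
  then show "has_bochner_integral std_normal (\<lambda>x. x ^ 4) 3"
    by (rule has_bochner_integral_density[rotated -1]) auto
qed

text \<open>
  Chebyshev's inequality for the chi-square distribution. The centred squares \<open>(g l)^2 - 1\<close> have mean zero
  and second moment 2, and they are orthogonal because expectations of products factorise. So the second
  moment of their sum is \<open>2 * card I\<close>.
\<close>
lemma measure_sq_deviation_std_normal_power:
  assumes "finite I" "t > 0"
  shows "measure (std_normal_power I) {g \<in> space (std_normal_power I). \<bar>(\<Sum>l\<in>I. (g l)\<^sup>2) - card I\<bar> \<ge> t}
     \<le> 2 * card I / t\<^sup>2"
proof -
  define \<gamma> where "\<gamma> = std_normal_power I"
  interpret \<gamma>: prob_space \<gamma> unfolding \<gamma>_def by (rule prob_space_std_normal_power)
  define w :: "real \<Rightarrow> real" where "w x = x\<^sup>2 - 1" for x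
  have one: "has_bochner_integral std_normal (\<lambda>_. 1 :: real) 1"
    by (simp add: has_bochner_integral_iff std_normal.prob_space[simplified])
  have w: "has_bochner_integral std_normal w 0"
    using has_bochner_integral_diff[OF std_normal_moments(1) one] by (simp add: w_def[abs_def])
  have "has_bochner_integral std_normal (\<lambda>x. x ^ 4 - x\<^sup>2 - x\<^sup>2 + 1) (3 - 1 - 1 + 1)"
    by (intro has_bochner_integral_add has_bochner_integral_diff std_normal_moments one)
  also have "(\<lambda>x. x ^ 4 - x\<^sup>2 - x\<^sup>2 + 1) = (\<lambda>x. w x * w x)"
    by (simp add: fun_eq_iff w_def algebra_simps power2_eq_square power4_eq_xxxx)
  finally have w2: "has_bochner_integral std_normal (\<lambda>x. w x * w x) 2" by simp
  have prod: "has_bochner_integral \<gamma> (\<lambda>g. w (g l) * w (g k)) (if k = l then 2 else 0)"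
    if "l \<in> I" "k \<in> I" for l k
  proof -
    \<comment> \<open>The product \<open>w (g l) * w (g k)\<close> written as a product over all coordinates, which covers \<open>k = l\<close> as well.\<close>
    define f where "f i x = (if i = l then w x else 1) * (if i = k then w x else 1)" for i x
    have f: "has_bochner_integral std_normal (f i) (if i = l \<and> i = k then 2 else if i = l \<or> i
        = k then 0 else 1)" for i
      using w w2 one
      by (auto simp: f_def[abs_def])
    have "w (g l) * w (g k) = (\<Prod>i\<in>I. f i (g i))" for g
      using that assms(1) unfolding f_def prod.distrib by (simp add: prod.delta)
    moreover have "integrable \<gamma> (\<lambda>g. \<Prod>i\<in>I. f i (g i))"
      unfolding \<gamma>_def using f by (intro std_normal_power.product_integrable_prod assms)
          (auto simp: has_bochner_integral_iff)
    moreover have "(\<integral>g. (\<Prod>i\<in>I. f i (g i)) \<partial>\<gamma>) = (\<Prod>i\<in>I. integral\<^sup>L std_normal (f i))"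
      unfolding \<gamma>_def using f by (intro std_normal_power.product_integral_prod assms)
          (auto simp: has_bochner_integral_iff)
    moreover have "\<dots> = (if k = l then 2 else 0)"
    proof (cases "k = l")
      case True
      then have "(\<Prod>i\<in>I. integral\<^sup>L std_normal (f i)) = (\<Prod>i\<in>I. if i = l then 2 else 1)"
        using f by (intro prod.cong) (auto simp: has_bochner_integral_iff)
      then show ?thesis using True that assms(1) by simp
    next
      case False
      have "integral\<^sup>L std_normal (f l) = 0" using f[of l] False by (auto simp: has_bochner_integral_iff)
      then show ?thesis using False that assms(1) by (auto intro!: prod_zero bexI[of _ l])
    qed
    ultimately show ?thesis by (simp add: has_bochner_integral_iff)
  qed
  have "has_bochner_integral \<gamma> (\<lambda>g. \<Sum>l\<in>I. \<Sum>k\<in>I. w (g l) * w (g k)) (\<Sum>l\<in>I. \<Sum>k\<in>I. if k = l then 2 else 0)"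
    by (intro has_bochner_integral_sum prod)
  moreover have "(\<Sum>l\<in>I. \<Sum>k\<in>I. w (g l) * w (g k)) = ((\<Sum>l\<in>I. (g l)\<^sup>2) - card I)\<^sup>2" for g
    unfolding power2_eq_square[of "_ - _"] sum_product[symmetric] by (simp add: w_def sum_subtractf)
  moreover have "(\<Sum>l\<in>I. \<Sum>k\<in>I. if k = l then 2 else 0) = (2 * card I :: real)"
    using assms(1) by simp
  ultimately have B: "has_bochner_integral \<gamma> (\<lambda>g. ((\<Sum>l\<in>I. (g l)\<^sup>2) - card I)\<^sup>2) (2 * card I)" by simp
  have "measure \<gamma> {g \<in> space \<gamma>. ((\<Sum>l\<in>I. (g l)\<^sup>2) - card I)\<^sup>2 \<ge> t\<^sup>2} \<le>
      (\<integral>g. ((\<Sum>l\<in>I. (g l)\<^sup>2) - card I)\<^sup>2 \<partial>\<gamma>) / t\<^sup>2"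
    using B assms(2) by (intro integral_Markov_inequality_measure[where A="{}"])
        (auto simp: has_bochner_integral_iff)
  also have "\<dots> = 2 * card I / t\<^sup>2" using B by (simp add: has_bochner_integral_iff)
  also have "{g \<in> space \<gamma>. ((\<Sum>l\<in>I. (g l)\<^sup>2) - card I)\<^sup>2 \<ge> t\<^sup>2} = {g
      \<in> space \<gamma>. \<bar>(\<Sum>l\<in>I. (g l)\<^sup>2) - card I\<bar> \<ge> t}"
    using assms(2) by (auto simp: abs_le_square_iff[symmetric])
  finally show ?thesis unfolding \<gamma>_def .
qed

text \<open>
  By rotation invariance the linear form has the law of \<open>L2_set u I\<close> times a standard normal, so this is
  Chebyshev's inequality for one normal variable.
\<close>
lemma measure_linear_deviation_std_normal_power:
  assumes "finite I" "I \<noteq> {}"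
  shows "measure (std_normal_power I)
      {g \<in> space (std_normal_power I). \<bar>\<Sum>l\<in>I. g l * u l\<bar> > 2 * L2_set u I} \<le> 1 / 4"
proof -
  define \<gamma> where "\<gamma> = std_normal_power I"
  interpret \<gamma>: prob_space \<gamma> unfolding \<gamma>_def by (rule prob_space_std_normal_power)
  obtain i where i: "i \<in> I" using assms by auto
  have meas: "{g \<in> space \<gamma>. \<bar>\<Sum>l\<in>I. g l * u l\<bar> > 2 * L2_set u I} \<in> sets \<gamma>"
    unfolding \<gamma>_def by measurable
  have "emeasure \<gamma> {g \<in> space \<gamma>. \<bar>\<Sum>l\<in>I. g l * u l\<bar> > 2 * L2_set u I} =
     (\<integral>\<^sup>+g. indicator {v. \<bar>v\<bar> > 2 * L2_set u I} (\<Sum>l\<in>I. g l * u l) \<partial>\<gamma>)"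
    unfolding nn_integral_indicator[OF meas, symmetric] by (intro nn_integral_cong)
        (auto split: split_indicator)
  also have "\<dots> = (\<integral>\<^sup>+x. indicator {v. \<bar>v\<bar> > 2 * L2_set u I} (L2_set u I * x) \<partial>std_normal)"
    unfolding \<gamma>_def by (intro nn_integral_std_normal_power_linear[OF assms(1) i]) measurable
  also have "\<dots> \<le> (\<integral>\<^sup>+x. indicator {x. \<bar>x\<bar> \<ge> 2} x \<partial>std_normal)"
  proof (intro nn_integral_mono)
    fix x :: real
    have "\<bar>x\<bar> \<ge> 2" if "\<bar>L2_set u I * x\<bar> > 2 * L2_set u I"
    proof (rule ccontr)
      assume "\<not> \<bar>x\<bar> \<ge> 2"
      then have "L2_set u I * \<bar>x\<bar> \<le> L2_set u I * 2" by (intro mult_left_mono) auto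
      then show False using that by (simp add: abs_mult)
    qed
    then show "indicator {v. \<bar>v\<bar> > 2 * L2_set u I} (L2_set u I * x) \<le> (indicator {x. \<bar>x\<bar> \<ge> 2} x :: ennreal)"
      by (auto split: split_indicator)
  qed
  also have "\<dots> = emeasure std_normal {x \<in> space std_normal. x\<^sup>2 \<ge> 2\<^sup>2}"
  proof -
    have "{x :: real. \<bar>x\<bar> \<ge> 2} = {x \<in> space std_normal. x\<^sup>2 \<ge> 2\<^sup>2}"
      using abs_le_square_iff[of 2] by auto
    then show ?thesis by (subst nn_integral_indicator) auto
  qed
  finally have "measure \<gamma> {g \<in> space \<gamma>. \<bar>\<Sum>l\<in>I. g l * u l\<bar> > 2 * L2_set u I} \<le>
      measure std_normal {x \<in> space std_normal. x\<^sup>2 \<ge> 2\<^sup>2}"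
    unfolding \<gamma>.emeasure_eq_measure std_normal.emeasure_eq_measure by simp
  also have "\<dots> \<le> (\<integral>x. x\<^sup>2 \<partial>std_normal) / 2\<^sup>2"
    using std_normal_moments(1) by (intro integral_Markov_inequality_measure[where A="{}"])
        (auto simp: has_bochner_integral_iff)
  also have "\<dots> = 1 / 4" using std_normal_moments(1) by (simp add: has_bochner_integral_iff)
  finally show ?thesis unfolding \<gamma>_def .
qed

section \<open>Change of measure for the observations\<close>

text \<open>
  A change of measure in each coordinate yields one for the product. It is used twice, since the noise is a
  product over observations of products over coordinates.
\<close>
lemma distr_PiM_density:
  assumes I: "finite I" and M: "\<And>i. prob_space (M i)"
    and t: "\<And>i. i \<in> I \<Longrightarrow> t i \<in> M i \<rightarrow>\<^sub>M M i"
    and f: "\<And>i. i \<in> I \<Longrightarrow> f i \<in> borel_measurable (M i)"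
    and eq: "\<And>i. i \<in> I \<Longrightarrow> distr (M i) (M i) (t i) = density (M i) (f i)"
  shows "distr (PiM I M) (PiM I M) (\<lambda>x. \<lambda>i\<in>I. t i (x i)) = density (PiM I M) (\<lambda>x. \<Prod>i\<in>I. f i (x i))"
proof -
  interpret M: product_prob_space M I by (rule product_prob_spaceI) (rule M)
  define N where "N i = (if i \<in> I then distr (M i) (M i) (t i) else M i)" for i
  have N: "prob_space (N i)" for i
    using M t by (auto simp: N_def intro!: prob_space.prob_space_distr)
  interpret N: product_prob_space N I by (rule product_prob_spaceI) (rule N)
  have sets_N: "sets (N i) = sets (M i)" for i by (simp add: N_def)
  have sets_PN: "sets (PiM I N) = sets (PiM I M)" by (intro sets_PiM_cong) (simp_all add: sets_N)
  have T: "(\<lambda>x. \<lambda>i\<in>I. t i (x i)) \<in> PiM I M \<rightarrow>\<^sub>M PiM I M"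
    using t by (intro measurable_restrict measurable_compose[OF measurable_component_singleton]) auto
  have F: "(\<lambda>x. \<Prod>i\<in>I. f i (x i)) \<in> borel_measurable (PiM I M)"
    using f by (intro borel_measurable_prod_ennreal
        measurable_compose[OF measurable_component_singleton]) auto
  have "distr (PiM I M) (PiM I M) (\<lambda>x. \<lambda>i\<in>I. t i (x i)) = PiM I N"
  proof (rule N.PiM_eqI)
    fix A assume "\<And>i. i \<in> I \<Longrightarrow> A i \<in> sets (N i)"
    then have A: "\<And>i. i \<in> I \<Longrightarrow> A i \<in> sets (M i)" by (simp add: sets_N)
    have "emeasure (distr (PiM I M) (PiM I M) (\<lambda>x. \<lambda>i\<in>I. t i (x i))) (PiE I A) =
        emeasure (PiM I M) ((\<lambda>x. \<lambda>i\<in>I. t i (x i)) -` PiE I A \<inter> space (PiM I M))"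
      using A I T by (intro emeasure_distr sets_PiM_I_finite) auto
    also have "(\<lambda>x. \<lambda>i\<in>I. t i (x i)) -` PiE I A \<inter> space (PiM I M) = PiE I (\<lambda>i. t i -` A i \<inter> space (M i))"
      by (auto simp: space_PiM PiE_iff)
    also have "emeasure (PiM I M) \<dots> = (\<Prod>i\<in>I. emeasure (M i) (t i -` A i \<inter> space (M i)))"
      using A t I by (intro M.emeasure_PiM) auto
    also have "\<dots> = (\<Prod>i\<in>I. emeasure (N i) (A i))"
      using A t by (intro prod.cong) (auto simp: N_def emeasure_distr)
    finally show "emeasure (distr (PiM I M) (PiM I M) (\<lambda>x. \<lambda>i\<in>I. t i (x i))) (PiE I A) =
      (\<Prod>i\<in>I. emeasure (N i) (A i))" .
  qed (use I sets_PN in auto)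
  moreover have "density (PiM I M) (\<lambda>x. \<Prod>i\<in>I. f i (x i)) = PiM I N"
  proof (rule N.PiM_eqI)
    fix A assume "\<And>i. i \<in> I \<Longrightarrow> A i \<in> sets (N i)"
    then have A: "\<And>i. i \<in> I \<Longrightarrow> A i \<in> sets (M i)" by (simp add: sets_N)
    have "emeasure (density (PiM I M) (\<lambda>x. \<Prod>i\<in>I. f i (x i))) (PiE I A) =
       (\<integral>\<^sup>+x. (\<Prod>i\<in>I. f i (x i)) * indicator (PiE I A) x \<partial>PiM I M)"
      using A I F by (intro emeasure_density sets_PiM_I_finite) auto
    also have "\<dots> = (\<integral>\<^sup>+x. (\<Prod>i\<in>I. f i (x i) * indicator (A i) (x i)) \<partial>PiM I M)"
      using I by (intro nn_integral_cong) (simp add: indicator_PiE_prod prod.distrib space_PiM PiE_iff)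
    also have "\<dots> = (\<Prod>i\<in>I. \<integral>\<^sup>+x. f i x * indicator (A i) x \<partial>M i)"
      using A f I by (intro M.product_nn_integral_prod) auto
    also have "\<dots> = (\<Prod>i\<in>I. emeasure (N i) (A i))"
      using A f by (intro prod.cong) (auto simp: N_def eq emeasure_density)
    finally show "emeasure (density (PiM I M) (\<lambda>x. \<Prod>i\<in>I. f i (x i))) (PiE I A) =
      (\<Prod>i\<in>I. emeasure (N i) (A i))" .
  qed (use I sets_PN in auto)
  ultimately show ?thesis by simp
qed

text \<open>
  The one-dimensional Cameron--Martin formula.
\<close>
lemma distr_std_normal_shift:
  "distr std_normal std_normal (\<lambda>x. a + x) = density std_normal (\<lambda>x. ennreal (exp (a * x - a\<^sup>2 / 2)))"
proof (rule measure_eqI)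
  fix A assume "A \<in> sets (distr std_normal std_normal (\<lambda>x. a + x))"
  then have [measurable]: "A \<in> sets borel" by simp
  have eq: "std_normal_density (- a + x) = exp (a * x - a\<^sup>2 / 2) * std_normal_density x" for x
  proof -
    have "- (- a + x)\<^sup>2 / 2 = (a * x - a\<^sup>2 / 2) + - x\<^sup>2 / 2"
      by (simp add: power2_eq_square field_simps)
    then show ?thesis unfolding std_normal_density_def by (simp only: exp_add mult_ac)
  qed
  have "emeasure (distr std_normal std_normal (\<lambda>x. a + x)) A = (\<integral>\<^sup>+x. indicator A (a + x) \<partial>std_normal)"
    by (intro emeasure_distr_nn_integral) simp_all
  also have "\<dots> = (\<integral>\<^sup>+x. ennreal (std_normal_density x) * indicator A (a + x) \<partial>lborel)"
    by (simp add: nn_integral_density)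
  also have "\<dots> = (\<integral>\<^sup>+x. ennreal (std_normal_density (- a + x)) * indicator A x \<partial>lborel)"
    using nn_integral_real_affine[of "\<lambda>x. ennreal (std_normal_density x) * indicator A (a + x)" 1 "-a"]
    by simp
  also have "\<dots> = (\<integral>\<^sup>+x. ennreal (std_normal_density x) * (ennreal (exp (a * x - a\<^sup>2 / 2))
      * indicator A x) \<partial>lborel)"
    unfolding eq by (simp add: ennreal_mult mult_ac)
  also have "\<dots> = emeasure (density std_normal (\<lambda>x. ennreal (exp (a * x - a\<^sup>2 / 2)))) A"
    by (simp add: emeasure_density nn_integral_density)
  finally show "emeasure (distr std_normal std_normal (\<lambda>x. a + x)) A =
    emeasure (density std_normal (\<lambda>x. ennreal (exp (a * x - a\<^sup>2 / 2)))) A" .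
qed simp

lemma distr_std_normal_power_shift:
  assumes "finite L"
  shows "distr (std_normal_power L) (std_normal_power L) (\<lambda>x. \<lambda>l\<in>L. a l + x l) =
    density (std_normal_power L) (\<lambda>x. ennreal (exp (\<Sum>l\<in>L. a l * x l - (a l)\<^sup>2 / 2)))"
  using distr_PiM_density[OF assms, of "\<lambda>_. std_normal" "\<lambda>l x. a l + x" "\<lambda>l x. ennreal (exp (a l
      * x - (a l)\<^sup>2 / 2))"]
    distr_std_normal_shift prob_space_std_normal
  by (simp add: prod_ennreal exp_sum assms)

lemma sets_noise: "sets (noise n p) = sets (obs_space n p)"
  unfolding noise_def std_gaussian_vector_def obs_space_def by (intro sets_PiM_cong) auto

lemma measurable_noise_component:
  assumes "i < n" "l < p"
  shows "(\<lambda>x. x i l) \<in> borel_measurable (noise n p)"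
proof -
  have "(\<lambda>x. x i) \<in> noise n p \<rightarrow>\<^sub>M std_gaussian_vector p"
    unfolding noise_def using assms by (intro measurable_component_singleton) simp
  moreover have "(\<lambda>x. x l) \<in> std_gaussian_vector p \<rightarrow>\<^sub>M std_normal"
    unfolding std_gaussian_vector_def using assms by (intro measurable_component_singleton) simp
  ultimately have "(\<lambda>x. x i l) \<in> noise n p \<rightarrow>\<^sub>M std_normal" by (rule measurable_compose)
  then show ?thesis by simp
qed

text \<open>
  The likelihood ratio of the data to pure noise depends on the data only through \<open>\<Sum>i. \<eta> i * x i\<close>, because
  \<open>(\<eta> i)^2 = 1\<close>.
\<close>
lemma obs_law_density:
  assumes "\<eta> \<in> labels n" and \<phi>: "\<phi> \<in> borel_measurable (obs_space n p)"
  shows "(\<integral>\<^sup>+y. \<phi> y \<partial>obs_law n p 1 u \<eta>) =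
    (\<integral>\<^sup>+x. \<phi> x * ennreal (exp ((\<Sum>l<p. u l * (\<Sum>i<n. \<eta> i * x i l)) - real n / 2 * (\<Sum>l<p. (u l)\<^sup>2)))
        \<partial>noise n p)"
proof -
  define f where "f i x = ennreal (exp (\<Sum>l<p. u l * \<eta> i * x l - (u l * \<eta> i)\<^sup>2 / 2))" for i and x :: "nat
      \<Rightarrow> real"
  have f_meas: "f i \<in> borel_measurable (std_gaussian_vector p)" for i
    unfolding f_def std_gaussian_vector_def by measurable
  have sq: "(\<eta> i)\<^sup>2 = 1" if "i < n" for i
    using assms(1) that by (auto simp: labels_def PiE_iff power2_eq_1_iff)
  have "obs_law n p 1 u \<eta> = distr (noise n p) (noise n p) (\<lambda>x. \<lambda>i\<in>{..<n}. \<lambda>l\<in>{..<p}. u l * \<eta> i + x i l)"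
    unfolding obs_law_def observation_def by (intro distr_cong) (simp_all add: sets_noise)
  also have "\<dots> = density (noise n p) (\<lambda>x. \<Prod>i\<in>{..<n}. f i (x i))"
    unfolding noise_def
  proof (rule distr_PiM_density)
    show "distr (std_gaussian_vector p) (std_gaussian_vector p) (\<lambda>x. \<lambda>l\<in>{..<p}. u l * \<eta> i + x l) =
        density (std_gaussian_vector p) (f i)" for i
      unfolding f_def std_gaussian_vector_def by (rule distr_std_normal_power_shift) simp
    show "(\<lambda>x. \<lambda>l\<in>{..<p}. u l * \<eta> i + x l) \<in> std_gaussian_vector p \<rightarrow>\<^sub>M std_gaussian_vector p" for i
      unfolding std_gaussian_vector_def by measurable
    show "prob_space (std_gaussian_vector p)"
      unfolding std_gaussian_vector_def by (rule prob_space_std_normal_power)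
  qed (simp_all add: f_meas)
  also have "(\<lambda>x. \<Prod>i\<in>{..<n}. f i (x i)) = 
    (\<lambda>x. ennreal (exp ((\<Sum>l<p. u l * (\<Sum>i<n. \<eta> i * x i l)) - real n / 2 * (\<Sum>l<p. (u l)\<^sup>2))))"
  proof
    fix x :: "nat \<Rightarrow> nat \<Rightarrow> real"
    have "(\<Prod>i\<in>{..<n}. f i (x i)) = ennreal (exp (\<Sum>i<n. \<Sum>l<p. u l * \<eta> i * x i l - (u l * \<eta> i)\<^sup>2 / 2))"
      by (simp only: f_def prod_ennreal exp_ge_zero exp_sum[OF finite_lessThan, symmetric])
    also have "(\<Sum>i<n. \<Sum>l<p. u l * \<eta> i * x i l - (u l * \<eta> i)\<^sup>2 / 2) =
       (\<Sum>i<n. \<Sum>l<p. u l * \<eta> i * x i l - (u l)\<^sup>2 / 2)"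
      by (intro sum.cong refl) (simp add: power_mult_distrib sq)
    also have "\<dots> = (\<Sum>i<n. \<Sum>l<p. u l * (\<eta> i * x i l)) - real n / 2 * (\<Sum>l<p. (u l)\<^sup>2)"
      by (simp add: sum_subtractf sum_divide_distrib[symmetric] mult.assoc)
    also have "(\<Sum>i<n. \<Sum>l<p. u l * (\<eta> i * x i l)) = (\<Sum>l<p. u l * (\<Sum>i<n. \<eta> i * x i l))"
      unfolding sum_distrib_left by (rule sum.swap)
    finally show "(\<Prod>i\<in>{..<n}. f i (x i)) =
      ennreal (exp ((\<Sum>l<p. u l * (\<Sum>i<n. \<eta> i * x i l)) - real n / 2 * (\<Sum>l<p. (u l)\<^sup>2)))" .
  qed
  finally have law: "obs_law n p 1 u \<eta> = density (noise n p)
    (\<lambda>x. ennreal (exp ((\<Sum>l<p. u l * (\<Sum>i<n. \<eta> i * x i l)) - real n / 2 * (\<Sum>l<p. (u l)\<^sup>2))))" .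
  have \<phi>': "\<phi> \<in> borel_measurable (noise n p)"
    using \<phi> measurable_cong_sets[OF sets_noise refl] by blast
  have "(\<lambda>x. (\<Sum>l<p. u l * (\<Sum>i<n. \<eta> i * x i l)) - real n / 2 * (\<Sum>l<p. (u l)\<^sup>2)) \<in>
      borel_measurable (noise n p)"
    by (intro borel_measurable_diff borel_measurable_sum
        borel_measurable_times measurable_noise_component) auto
  then have "(\<lambda>x. ennreal (exp ((\<Sum>l<p. u l * (\<Sum>i<n. \<eta> i * x i l)) - real n / 2 * (\<Sum>l<p. (u l)\<^sup>2))))
      \<in> borel_measurable (noise n p)" by measurable
  then show ?thesis unfolding law by (subst nn_integral_density[OF _ \<phi>']) (simp_all add: mult.commute)
qed

section \<open>The probability of a sign error for a fixed direction\<close>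

text \<open>
  The factor lost to the fluctuations of the sum of \<open>m\<close> label-corrected observations: the numerator
  accounts for its component along the signal and the denominator for its norm.
\<close>
definition snr_inflation :: "nat \<Rightarrow> real" where
  "snr_inflation m = (1 + 2 / sqrt m) / sqrt (1 - 6 / sqrt m)"

text \<open>
  The expression on the right is the squared norm of \<open>m u + \<surd>m z\<close> for \<open>\<parallel>u\<parallel> = D\<close>, \<open>\<langle>z, u\<rangle> = v\<close> and
  \<open>\<parallel>z\<parallel>^2 = q\<close>. The relative loss \<open>6 / \<surd>m\<close> collects \<open>4 / \<surd>m\<close> from the cross term, where \<open>D \<le> D^2\<close>,
  and \<open>2 / \<surd>m\<close> from the deviation of \<open>q\<close>, where \<open>4 m \<surd>p \<le> 2 \<surd>m p + 2 m \<surd>m\<close> lets one part be charged to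
  \<open>p\<close> and the other to \<open>D^2\<close>.
\<close>
lemma signal_sum_norm_lower:
  fixes D m p q v :: real
  assumes "D \<ge> 1" "m > 0" "p \<ge> 0" "\<bar>q - p\<bar> \<le> 4 * sqrt p" "\<bar>v\<bar> \<le> 2 * D"
  shows "m\<^sup>2 * (1 - 6 / sqrt m) * (D\<^sup>2 + p / m) \<le> m\<^sup>2 * D\<^sup>2 + 2 * m * sqrt m * v + m * q"
proof -
  define s where "s = sqrt m"
  define t where "t = sqrt p"
  have s: "s > 0" "m = s\<^sup>2" and t: "t \<ge> 0" "p = t\<^sup>2" using assms by (simp_all add: s_def t_def)
  have D: "D \<le> D\<^sup>2" "1 \<le> D\<^sup>2" using assms(1) by (simp_all add: power2_eq_square
      mult_left_mono[of 1 D D, simplified] mult_mono[of 1 D 1 D, simplified])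
  have "s\<^sup>2 * q \<ge> s\<^sup>2 * (t\<^sup>2 - 4 * t)"
    using assms(4) t by (intro mult_left_mono) (auto simp: t_def[symmetric] abs_le_iff)
  moreover have "2 * s ^ 3 * v \<ge> 2 * s ^ 3 * (- 2 * D\<^sup>2)"
    using assms(5) D s by (intro mult_left_mono) (auto simp: abs_le_iff)
  moreover have "4 * s\<^sup>2 * t \<le> 2 * s * t\<^sup>2 + 2 * s ^ 3 * D\<^sup>2"
  proof -
    have "2 * s * (s - t)\<^sup>2 \<ge> 0" using s by simp
    moreover have "2 * s ^ 3 \<le> 2 * s ^ 3 * D\<^sup>2" using s D by simp
    ultimately show ?thesis by (simp add: power2_eq_square power3_eq_cube algebra_simps)
  qed
  moreover have "2 * s * t\<^sup>2 \<le> 6 * s * t\<^sup>2" using s by simp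
  moreover have "m\<^sup>2 * (1 - 6 / sqrt m) * (D\<^sup>2 + p / m) = s ^ 4 * D\<^sup>2 - 6 * s ^ 3 * D\<^sup>2 + s\<^sup>2 * t\<^sup>2 - 6
      * s * t\<^sup>2"
    unfolding s_def[symmetric] using s(1) by (simp add: s(2) t(2) field_simps eval_nat_numeral)
  moreover have "m\<^sup>2 * D\<^sup>2 + 2 * m * sqrt m * v + m * q = s ^ 4 * D\<^sup>2 + 2 * s ^ 3 * v + s\<^sup>2 * q"
    unfolding s_def[symmetric] by (simp add: s(2) eval_nat_numeral)
  ultimately show ?thesis by (simp add: algebra_simps)
qed

lemma normal_tail_antimono: "s \<le> t \<Longrightarrow> normal_tail t \<le> normal_tail s"
  unfolding normal_tail_def by (intro std_normal.finite_measure_mono) auto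

text \<open>
  The two exceptional events have probability at most \<open>1/8\<close> and \<open>1/4\<close>.
\<close>
lemma measure_good_direction:
  assumes "p > 0"
  shows "measure (std_gaussian_vector p) {z \<in> space (std_gaussian_vector p).
      \<bar>(\<Sum>l<p. (z l)\<^sup>2) - real p\<bar> \<le> 4 * sqrt p \<and> \<bar>\<Sum>l<p. z l * u l\<bar> \<le> 2 * L2_set u {..<p}} \<ge> 1 / 2"
    (is "measure ?\<gamma> ?G \<ge> _")
proof -
  interpret prob_space ?\<gamma> unfolding std_gaussian_vector_def by (rule prob_space_std_normal_power)
  define A where "A = {z \<in> space ?\<gamma>. \<bar>(\<Sum>l<p. (z l)\<^sup>2) - real p\<bar> \<ge> 4 * sqrt p}"
  define B where "B = {z \<in> space ?\<gamma>. \<bar>\<Sum>l<p. z l * u l\<bar> > 2 * L2_set u {..<p}}"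
  have AB: "A \<in> sets ?\<gamma>" "B \<in> sets ?\<gamma>"
    unfolding A_def B_def std_gaussian_vector_def by measurable
  have G: "?G \<in> sets ?\<gamma>" unfolding std_gaussian_vector_def by measurable
  have "measure ?\<gamma> A \<le> 2 * real p / (4 * sqrt p)\<^sup>2"
    using measure_sq_deviation_std_normal_power[of "{..<p}" "4 * sqrt p"] assms
    unfolding A_def std_gaussian_vector_def by simp
  also have "\<dots> = 1 / 8" using assms by (simp add: power_mult_distrib)
  finally have a: "measure ?\<gamma> A \<le> 1 / 8" .
  have b: "measure ?\<gamma> B \<le> 1 / 4"
    using measure_linear_deviation_std_normal_power[of "{..<p}" u] assms
    unfolding B_def std_gaussian_vector_def by (auto simp: lessThan_empty_iff)
  have "space ?\<gamma> \<subseteq> ?G \<union> (A \<union> B)" by (auto simp: A_def B_def)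
  have "1 = measure ?\<gamma> (space ?\<gamma>)" by (simp add: prob_space)
  also have "\<dots> \<le> measure ?\<gamma> (?G \<union> (A \<union> B))"
    by (intro finite_measure_mono sets.Un G AB \<open>space ?\<gamma> \<subseteq> ?G \<union> (A \<union> B)\<close>)
  also have "\<dots> \<le> measure ?\<gamma> ?G + measure ?\<gamma> (A \<union> B)"
    using G AB by (intro measure_Un_le sets.Un)
  also have "measure ?\<gamma> (A \<union> B) \<le> measure ?\<gamma> A + measure ?\<gamma> B"
    using AB by (intro measure_Un_le)
  finally show ?thesis using a b by simp
qed

text \<open>
  For fixed \<open>S\<close>, the form \<open>\<langle>x, S\<rangle>\<close> is \<open>\<parallel>S\<parallel>\<close> times a standard normal, so \<open>\<langle>u + s x, S\<rangle> \<le> 0\<close> has probability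
  \<open>P(N(0,1) \<ge> \<langle>u, S\<rangle> / \<parallel>S\<parallel>)\<close>. The bound is phrased with an upper bound \<open>A\<close> on \<open>\<langle>u, S\<rangle>\<close> and without a
  division, so that \<open>S = 0\<close> needs no special treatment.
\<close>
lemma sign_error_given_direction:
  fixes S :: "nat \<Rightarrow> real" and \<Sigma> A t :: real
  assumes "p > 0" "s = 1 \<or> s = -1"
    and A: "(\<Sum>l<p. u l * S l) \<le> A" and \<Sigma>: "A \<le> L2_set S {..<p} * t"
    and "t \<ge> 0"
  shows "ennreal (normal_tail t) \<le>
    (\<integral>\<^sup>+x. indicator {r. r \<le> 0} (\<Sum>l<p. (u l + s * x l) * S l) \<partial>std_gaussian_vector p)"
proof -
  define T where "T l = - s * S l" for l
  have s2: "s\<^sup>2 = 1" using assms(2) by auto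
  have T: "L2_set T {..<p} = L2_set S {..<p}" by (simp add: L2_set_def T_def power_mult_distrib s2)
  define b where "b = (\<Sum>l<p. u l * S l)"
  have "ennreal (normal_tail t) = (\<integral>\<^sup>+y. indicator {t<..} y \<partial>std_normal)"
    unfolding normal_tail_def by (subst nn_integral_indicator) (auto simp: std_normal.emeasure_eq_measure)
  also have "\<dots> \<le> (\<integral>\<^sup>+y. indicator {v. b \<le> v} (L2_set T {..<p} * y) \<partial>std_normal)"
  proof (intro nn_integral_mono)
    fix y :: real
    have "b \<le> L2_set T {..<p} * y" if "y > t"
    proof -
      have "L2_set T {..<p} * t \<le> L2_set T {..<p} * y" using that by (intro mult_left_mono) auto
      then show ?thesis using A \<Sigma> by (simp add: b_def T)
    qed
    then show "indicator {t<..} y \<le> (indicator {v. b \<le> v} (L2_set T {..<p} * y) :: ennreal)"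
      by (auto split: split_indicator)
  qed
  also have "\<dots> = (\<integral>\<^sup>+x. indicator {v. b \<le> v} (\<Sum>l<p. x l * T l) \<partial>std_gaussian_vector p)"
    unfolding std_gaussian_vector_def using assms(1)
    by (intro nn_integral_std_normal_power_linear[symmetric, of _ 0]) simp_all
  also have "\<dots> = (\<integral>\<^sup>+x. indicator {r. r \<le> 0} (\<Sum>l<p. (u l + s * x l) * S l) \<partial>std_gaussian_vector p)"
  proof (intro nn_integral_cong)
    fix x :: "nat \<Rightarrow> real"
    have "(\<Sum>l<p. (u l + s * x l) * S l) = b - (\<Sum>l<p. x l * T l)"
      unfolding b_def T_def sum_subtractf[symmetric] by (intro sum.cong) (simp_all add: algebra_simps)
    then show "indicator {v. b \<le> v} (\<Sum>l<p. x l * T l) =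
       (indicator {r. r \<le> 0} (\<Sum>l<p. (u l + s * x l) * S l) :: ennreal)"
      by (auto split: split_indicator)
  qed
  finally show ?thesis .
qed

text \<open>
  Conditionally on a vector \<open>z\<close> in the good event, \<open>\<langle>u, S\<rangle> \<le> m D^2 (1 + 2 / \<surd>m)\<close> and
  \<open>\<parallel>S\<parallel> \<ge> m \<surd>(1 - 6 / \<surd>m) \<surd>(D^2 + p/m)\<close> for \<open>S = m u + \<surd>m z\<close>. The ratio of the two bounds is the
  argument of the tail, and the factor \<open>1/2\<close> is the probability of the good event. For \<open>m > 36\<close> the square
  root of \<open>1 - 6 / \<surd>m\<close> is positive.
\<close>
lemma sign_error_lower_bound:
  fixes u :: "nat \<Rightarrow> real" and D :: real
  assumes "p > 0" "s = 1 \<or> s = -1" and D: "L2_set u {..<p} = D" "D \<ge> 1" and m: "m > 36"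
  shows "ennreal (normal_tail (D\<^sup>2 / sqrt (D\<^sup>2 + p / m) * snr_inflation m) / 2) \<le>
    (\<integral>\<^sup>+z. \<integral>\<^sup>+x. indicator {r. r \<le> 0} (\<Sum>l<p. (u l + s * x l) * (m * u l + sqrt m * z l))
       \<partial>std_gaussian_vector p \<partial>std_gaussian_vector p)"
proof -
  define \<gamma> where "\<gamma> = std_gaussian_vector p"
  define t where "t = D\<^sup>2 / sqrt (D\<^sup>2 + p / m) * snr_inflation m"
  define G where "G = {z \<in> space \<gamma>.
      \<bar>(\<Sum>l<p. (z l)\<^sup>2) - real p\<bar> \<le> 4 * sqrt p \<and> \<bar>\<Sum>l<p. z l * u l\<bar> \<le> 2 * L2_set u {..<p}}"
  interpret \<gamma>: prob_space \<gamma> unfolding \<gamma>_def std_gaussian_vector_def by (rule prob_space_std_normal_power)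
  have G: "G \<in> sets \<gamma>" unfolding G_def \<gamma>_def std_gaussian_vector_def by measurable
  have m6: "sqrt m > 6" using real_sqrt_less_mono[of 36 m] m by simp
  have u2: "(\<Sum>l<p. u l * u l) = D\<^sup>2"
    unfolding D(1)[symmetric] L2_set_def by (simp add: power2_eq_square sum_nonneg)
  have "6 / sqrt m \<le> 1" using m6 by (simp add: divide_le_eq)
  then have t0: "t \<ge> 0" using m6 by (auto simp: t_def snr_inflation_def intro!: mult_nonneg_nonneg
      divide_nonneg_nonneg)
  have "ennreal (normal_tail t / 2) \<le> ennreal (normal_tail t) * emeasure \<gamma> G"
  proof -
    have "normal_tail t * (1 / 2) \<le> normal_tail t * measure \<gamma> G"
      using measure_good_direction[OF assms(1)] unfolding G_def \<gamma>_def
      by (intro mult_left_mono) (auto simp: normal_tail_def)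
    then show ?thesis by (simp add: \<gamma>.emeasure_eq_measure ennreal_mult'[symmetric] normal_tail_def ennreal_leI)
  qed
  also have "\<dots> = (\<integral>\<^sup>+z. ennreal (normal_tail t) * indicator G z \<partial>\<gamma>)"
    using G by (simp add: nn_integral_cmult_indicator)
  also have "\<dots> \<le> (\<integral>\<^sup>+z. \<integral>\<^sup>+x. indicator {r. r \<le> 0} (\<Sum>l<p. (u l + s * x l) * (m * u l + sqrt m * z l)) \<partial>\<gamma>
      \<partial>\<gamma>)"
  proof (intro nn_integral_mono)
    fix z
    define S where "S l = m * u l + sqrt m * z l" for l
    define A where "A = m * D\<^sup>2 * (1 + 2 / sqrt m)"
    have "ennreal (normal_tail t) \<le> (\<integral>\<^sup>+x. indicator {r. r \<le> 0} (\<Sum>l<p. (u l + s * x l) * S l) \<partial>\<gamma>)"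
        if z: "z \<in> G"
      unfolding \<gamma>_def
    proof (rule sign_error_given_direction)
      have v: "\<bar>\<Sum>l<p. z l * u l\<bar> \<le> 2 * D" and q: "\<bar>(\<Sum>l<p. (z l)\<^sup>2) - real p\<bar> \<le> 4 * sqrt p"
        using z D by (auto simp: G_def)
      have DD: "D \<le> D\<^sup>2" using D(2) by (simp add: power2_eq_square)
      have "(\<Sum>l<p. u l * S l) = m * (\<Sum>l<p. u l * u l) + sqrt m * (\<Sum>l<p. z l * u l)"
        unfolding S_def sum_distrib_left sum.distrib[symmetric] by (intro sum.cong)
            (simp_all add: algebra_simps)
      also have "\<dots> \<le> m * D\<^sup>2 + sqrt m * (2 * D\<^sup>2)"
        unfolding u2 using v DD by (intro add_mono mult_left_mono) auto
      also have "\<dots> = A"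
      proof -
        have "m * (2 / sqrt m) = 2 * (m / sqrt m)" by simp
        then have "m * (2 / sqrt m) = 2 * sqrt m" using real_div_sqrt[of m] by simp
        moreover have "A = m * D\<^sup>2 + (m * (2 / sqrt m)) * D\<^sup>2"
          unfolding A_def by (simp only: distrib_left mult_1_right mult_ac)
        ultimately have "A = m * D\<^sup>2 + (2 * sqrt m) * D\<^sup>2" by (simp only:)
        then show ?thesis by (simp add: algebra_simps)
      qed
      finally show "(\<Sum>l<p. u l * S l) \<le> A" .
      have pos: "D\<^sup>2 + p / m > 0" "1 - 6 / sqrt m > 0"
        using D(2) m6 by (auto intro!: add_pos_nonneg simp: divide_less_eq)
      have "(\<Sum>l<p. (S l)\<^sup>2) = (\<Sum>l<p. m\<^sup>2 * (u l * u l) + 2 * m * sqrt m * (z l * u l) + m * (z l)\<^sup>2)"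
        unfolding S_def by (intro sum.cong refl)
            (simp add: power2_sum power_mult_distrib, simp add: power2_eq_square)
      also have "\<dots> = m\<^sup>2 * (\<Sum>l<p. u l * u l) + 2 * m * sqrt m * (\<Sum>l<p. z l * u l) + m * (\<Sum>l<p. (z l)\<^sup>2)"
        unfolding sum_distrib_left sum.distrib ..
      finally have "(\<Sum>l<p. (S l)\<^sup>2) \<ge> m\<^sup>2 * (1 - 6 / sqrt m) * (D\<^sup>2 + p / m)"
        unfolding u2 using signal_sum_norm_lower[of D m p _ "\<Sum>l<p. z l * u l"] D(2) m v q by simp
      then have "L2_set S {..<p} \<ge> sqrt (m\<^sup>2 * (1 - 6 / sqrt m) * (D\<^sup>2 + p / m))"
        unfolding L2_set_def by (rule real_sqrt_le_mono)
      then have "L2_set S {..<p} \<ge> m * sqrt (1 - 6 / sqrt m) * sqrt (D\<^sup>2 + p / m)"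
        by (simp add: real_sqrt_mult)
      then have "L2_set S {..<p} * t \<ge> m * sqrt (1 - 6 / sqrt m) * sqrt (D\<^sup>2 + p / m) * t"
        using t0 by (rule mult_right_mono)
      also have "m * sqrt (1 - 6 / sqrt m) * sqrt (D\<^sup>2 + p / m) * t = A"
      proof -
        define x y where "x = sqrt (1 - 6 / sqrt m)" and "y = sqrt (D\<^sup>2 + p / m)"
        have "x > 0" "y > 0" using pos unfolding x_def y_def by (simp_all only: real_sqrt_gt_0_iff)
        then show ?thesis
          unfolding t_def A_def snr_inflation_def x_def[symmetric] y_def[symmetric] by simp
      qed
      finally show "A \<le> L2_set S {..<p} * t" by simp
    qed (use assms t0 in auto)
    then show "ennreal (normal_tail t) * indicator G z \<le>
      (\<integral>\<^sup>+x. indicator {r. r \<le> 0} (\<Sum>l<p. (u l + s * x l) * (m * u l + sqrt m * z l)) \<partial>\<gamma>)"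
      by (auto simp: S_def split: split_indicator)
  qed
  finally show ?thesis unfolding \<gamma>_def t_def .
qed

section \<open>The spherical prior\<close>

definition spherical :: "nat \<Rightarrow> real \<Rightarrow> (nat \<Rightarrow> real) \<Rightarrow> nat \<Rightarrow> real" where
  "spherical p D g = (\<lambda>l\<in>{..<p}. D * g l / L2_set g {..<p})"

lemma measurable_vector_component:
  assumes "l < p"
  shows "(\<lambda>g. g l) \<in> borel_measurable (std_gaussian_vector p)"
proof -
  have "(\<lambda>g. g l) \<in> std_gaussian_vector p \<rightarrow>\<^sub>M std_normal"
    unfolding std_gaussian_vector_def using assms by (intro measurable_component_singleton) simp
  then show ?thesis by simp
qed

lemma AE_L2_set_spherical:
  assumes "p > 0" "D \<ge> 0"
  shows "AE g in std_gaussian_vector p. L2_set (spherical p D g) {..<p} = D"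
proof -
  have "AE x in std_normal. x \<noteq> 0"
    using AE_lborel_singleton[of "0::real"] by (subst AE_density) auto
  then have "AE g in std_gaussian_vector p. g 0 \<noteq> 0"
    unfolding std_gaussian_vector_def using assms(1)
    by (intro AE_PiM_component prob_space_std_normal) auto
  then show ?thesis
  proof eventually_elim
    fix g :: "nat \<Rightarrow> real" assume "g 0 \<noteq> 0"
    then have nz: "L2_set g {..<p} \<noteq> 0" using assms(1) by (auto simp: L2_set_eq_0_iff)
    have "L2_set (spherical p D g) {..<p} = L2_set (\<lambda>l. D / L2_set g {..<p} * g l) {..<p}"
      by (intro L2_set_cong) (simp_all add: spherical_def)
    also have "\<dots> = D / L2_set g {..<p} * L2_set g {..<p}"
      using assms(2) by (subst L2_set_right_distrib[symmetric]) (auto intro: divide_nonneg_nonneg)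
    finally show "L2_set (spherical p D g) {..<p} = D" using nz by simp
  qed
qed

definition label_sum :: "nat \<Rightarrow> (nat \<Rightarrow> real) \<Rightarrow> (nat \<Rightarrow> nat \<Rightarrow> real) \<Rightarrow> nat \<Rightarrow> real" where
  "label_sum n \<eta> x l = (\<Sum>i<n. \<eta> i * x i l)"

text \<open>
  The likelihood ratio at the direction \<open>D g / \<parallel>g\<parallel>\<close>, as a function of \<open>a = \<langle>g, T\<rangle>\<close> and \<open>q = \<parallel>g\<parallel>^2\<close>. The
  quotient \<open>q / (sqrt q)^2\<close> is 1 except at \<open>q = 0\<close>, where it is 0 just like the squared norm of
  \<open>spherical p D g\<close>; keeping it makes the identity with the likelihood hold for every \<open>g\<close>.
\<close>
definition spherical_likelihood_term :: "nat \<Rightarrow> real \<Rightarrow> real \<Rightarrow> real \<Rightarrow> ennreal" where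
  "spherical_likelihood_term n D a q = ennreal (exp (D * a / sqrt q - real n / 2 * (D\<^sup>2 * q / (sqrt q)\<^sup>2)))"

text \<open>
  The likelihood ratio averaged over the prior, for a vector \<open>T\<close> of norm \<open>t\<close>, which rotation invariance
  allows to be placed along the first coordinate axis.
\<close>
definition spherical_likelihood :: "nat \<Rightarrow> nat \<Rightarrow> real \<Rightarrow> real \<Rightarrow> ennreal" where
  "spherical_likelihood n p D t =
    (\<integral>\<^sup>+g. spherical_likelihood_term n D (t * g 0) (\<Sum>l<p. (g l)\<^sup>2) \<partial>std_gaussian_vector p)"

lemma measurable_spherical_likelihood_term:
  "(\<lambda>(a, q). spherical_likelihood_term n D a q) \<in> borel_measurable (borel \<Otimes>\<^sub>M borel)"
  unfolding spherical_likelihood_term_def by measurable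

lemma spherical_likelihood_rotation:
  assumes "p > 0"
  shows "(\<integral>\<^sup>+g. spherical_likelihood_term n D (\<Sum>l<p. g l * T l) (\<Sum>l<p. (g l)\<^sup>2) \<partial>std_gaussian_vector p) =
    spherical_likelihood n p D (L2_set T {..<p})"
  unfolding spherical_likelihood_def std_gaussian_vector_def using assms
  by (intro std_normal_power_rotation[where h="spherical_likelihood_term n D"]
      measurable_spherical_likelihood_term) simp_all

text \<open>
  By the symmetry of \<open>g 0\<close>, the average of \<open>exp\<close> is also an average of \<open>cosh\<close>, which increases with the
  absolute value of its argument. This makes the hypothesis with the larger \<open>\<parallel>T\<parallel>\<close> the more likely one.
\<close>
lemma spherical_likelihood_mono:
  assumes "p > 0" "D \<ge> 0" "0 \<le> s" "s \<le> t"
  shows "spherical_likelihood n p D s \<le> spherical_likelihood n p D t"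
proof -
  let ?h = "spherical_likelihood_term n D"
  have meas: "(\<lambda>g. ?h (r * g 0) (\<Sum>l<p. (g l)\<^sup>2)) \<in> borel_measurable (std_gaussian_vector p)" for r
  proof -
    have a: "(\<lambda>g. r * g 0) \<in> borel_measurable (std_gaussian_vector p)"
      using assms(1) by (intro borel_measurable_times borel_measurable_const measurable_vector_component)
    have b: "(\<lambda>g. \<Sum>l<p. (g l)\<^sup>2) \<in> borel_measurable (std_gaussian_vector p)"
      by (intro borel_measurable_sum borel_measurable_power measurable_vector_component) auto
    show ?thesis
      using measurable_compose[OF measurable_Pair[OF a b] measurable_spherical_likelihood_term[of n D]]
          by simp
  qed
  have sym: "2 * spherical_likelihood n p D r =
     (\<integral>\<^sup>+g. ?h (r * g 0) (\<Sum>l<p. (g l)\<^sup>2) + ?h (- r * g 0) (\<Sum>l<p. (g l)\<^sup>2) \<partial>std_gaussian_vector p)"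
         if "r \<ge> 0" for r
  proof -
    \<comment> \<open>Vectors \<open>r\<close> and \<open>- r\<close> along the first axis have the same norm, hence the same likelihood.\<close>
    define T where "T l = (if l = 0 then - r else 0)" for l :: nat
    have "L2_set T {..<p} = sqrt (\<Sum>l<p. if l = 0 then r\<^sup>2 else 0)"
      unfolding L2_set_def T_def by (intro arg_cong[where f=sqrt] sum.cong) auto
    also have "\<dots> = r" using assms(1) that by simp
    finally have T: "L2_set T {..<p} = r" .
    have "(\<Sum>l<p. g l * T l) = (\<Sum>l<p. if l = 0 then - r * g 0 else 0)" for g
      unfolding T_def by (intro sum.cong) auto
    then have T': "(\<Sum>l<p. g l * T l) = - r * g 0" for g using assms(1) by simp
    have "spherical_likelihood n p D r = 
        (\<integral>\<^sup>+g. ?h (- r * g 0) (\<Sum>l<p. (g l)\<^sup>2) \<partial>std_gaussian_vector p)"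
      using spherical_likelihood_rotation[OF assms(1), of n D T] unfolding T T' by simp
    moreover have "(\<integral>\<^sup>+g. ?h (r * g 0) (\<Sum>l<p. (g l)\<^sup>2) + ?h (- r * g 0) (\<Sum>l<p. (g l)\<^sup>2)
        \<partial>std_gaussian_vector p) =
      spherical_likelihood n p D r + (\<integral>\<^sup>+g. ?h (- r * g 0) (\<Sum>l<p. (g l)\<^sup>2) \<partial>std_gaussian_vector p)"
      unfolding spherical_likelihood_def by (intro nn_integral_add meas)
    ultimately show ?thesis by (simp add: mult_2)
  qed
  have pair: "?h a q + ?h (- a) q = ennreal (2 * exp (- (real n / 2 * (D\<^sup>2 * q / (sqrt q)\<^sup>2))) * cosh (D
      * a / sqrt q))" for a q
  proof -
    have "exp (b - c) + exp (- b - c) = 2 * exp (- c) * cosh b" for b c :: real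
    proof -
      have "2 * exp (- c) * cosh b = exp b * exp (- c) + exp (- b) * exp (- c)"
        by (simp add: cosh_field_def algebra_simps)
      then show ?thesis by (simp add: mult_exp_exp)
    qed
    from this[of "D * a / sqrt q"] show ?thesis
      unfolding spherical_likelihood_term_def by (subst ennreal_plus[symmetric]) simp_all
  qed
  have "2 * spherical_likelihood n p D s \<le> 2 * spherical_likelihood n p D t"
    unfolding sym[OF assms(3)] sym[OF order.trans[OF assms(3,4)]]
  proof (intro nn_integral_mono)
    fix g :: "nat \<Rightarrow> real"
    define q where "q = (\<Sum>l<p. (g l)\<^sup>2)"
    have q: "q \<ge> 0" by (simp add: q_def sum_nonneg)
    have "\<bar>D * (s * g 0) / sqrt q\<bar> \<le> \<bar>D * (t * g 0) / sqrt q\<bar>"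
      using assms q by (auto simp: abs_mult intro!: divide_right_mono mult_left_mono mult_right_mono)
    then have "cosh \<bar>D * (s * g 0) / sqrt q\<bar> \<le> cosh \<bar>D * (t * g 0) / sqrt q\<bar>"
      by (simp only: cosh_real_nonneg_le_iff abs_ge_zero)
    then have "cosh (D * (s * g 0) / sqrt q) \<le> cosh (D * (t * g 0) / sqrt q)"
      by (simp only: cosh_real_abs)
    then show "?h (s * g 0) q + ?h (- s * g 0) q \<le> ?h (t * g 0) q + ?h (- t * g 0) q"
      using pair[of "s * g 0" q] pair[of "t * g 0" q] by (simp add: ennreal_leI)
  qed
  then show ?thesis by (subst (asm) ennreal_mult_le_mult_iff) auto
qed

lemma measurable_spherical_likelihood:
  assumes "p > 0"
  shows "spherical_likelihood n p D \<in> borel_measurable borel"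
proof -
  interpret prob_space "std_gaussian_vector p"
    unfolding std_gaussian_vector_def by (rule prob_space_std_normal_power)
  have a: "(\<lambda>z. fst z * snd z 0) \<in> borel_measurable (borel \<Otimes>\<^sub>M std_gaussian_vector p)"
    using assms by (intro borel_measurable_times measurable_fst
        measurable_compose[OF measurable_snd measurable_vector_component])
  have b: "(\<lambda>z. \<Sum>l<p. (snd z l)\<^sup>2) \<in> borel_measurable (borel \<Otimes>\<^sub>M std_gaussian_vector p)"
    by (intro borel_measurable_sum borel_measurable_power
        measurable_compose[OF measurable_snd measurable_vector_component]) auto
  have "(\<lambda>(t, g). spherical_likelihood_term n D (t * g 0) (\<Sum>l<p. (g l)\<^sup>2))
      \<in> borel_measurable (borel \<Otimes>\<^sub>M std_gaussian_vector p)"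
    using measurable_compose[OF measurable_Pair[OF a b] measurable_spherical_likelihood_term[of n D]]
    by (simp add: case_prod_beta)
  then show ?thesis
    unfolding spherical_likelihood_def[abs_def] by (rule borel_measurable_nn_integral)
qed

lemma measurable_spherical_likelihood_joint:
  assumes \<phi>: "\<phi> \<in> borel_measurable (obs_space n p)"
  shows "(\<lambda>(g, x). \<phi> x * spherical_likelihood_term n D (\<Sum>l<p. g l * label_sum n \<eta> x l) (\<Sum>l<p. (g l)\<^sup>2))
      \<in> borel_measurable (std_gaussian_vector p \<Otimes>\<^sub>M noise n p)"
proof -
  have \<phi>': "\<phi> \<in> borel_measurable (noise n p)"
    using \<phi> measurable_cong_sets[OF sets_noise refl] by blast
  have m1: "(\<lambda>z. (\<Sum>l<p. fst z l * label_sum n \<eta> (snd z) l)) \<in>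
      borel_measurable (std_gaussian_vector p \<Otimes>\<^sub>M noise n p)"
    unfolding label_sum_def
    by (intro borel_measurable_sum borel_measurable_times borel_measurable_const
        measurable_compose[OF measurable_fst measurable_vector_component]
            measurable_compose[OF measurable_snd measurable_noise_component]) auto
  have m2: "(\<lambda>z. (\<Sum>l<p. (fst z l)\<^sup>2)) \<in> borel_measurable (std_gaussian_vector p \<Otimes>\<^sub>M noise n p)"
    by (intro borel_measurable_sum borel_measurable_power
        measurable_compose[OF measurable_fst measurable_vector_component]) auto
  show ?thesis
    using measurable_compose[OF measurable_Pair[OF m1 m2] measurable_spherical_likelihood_term[of n D]]
      measurable_compose[OF measurable_snd \<phi>']
    unfolding case_prod_beta by (intro borel_measurable_times_ennreal) simp_all
qed

lemma obs_law_spherical: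
  assumes "\<eta> \<in> labels n" and \<phi>: "\<phi> \<in> borel_measurable (obs_space n p)"
  shows "(\<integral>\<^sup>+y. \<phi> y \<partial>obs_law n p 1 (spherical p D g) \<eta>) =
    (\<integral>\<^sup>+x. \<phi> x * spherical_likelihood_term n D (\<Sum>l<p. g l * label_sum n \<eta> x l) (\<Sum>l<p. (g l)\<^sup>2) \<partial>noise n p)"
proof -
  have "ennreal (exp ((\<Sum>l<p. spherical p D g l * (\<Sum>i<n. \<eta> i * x i l)) - real n / 2
      * (\<Sum>l<p. (spherical p D g l)\<^sup>2))) =
      spherical_likelihood_term n D (\<Sum>l<p. g l * label_sum n \<eta> x l) (\<Sum>l<p. (g l)\<^sup>2)" for x
  proof -
    have "(\<Sum>l<p. spherical p D g l * (\<Sum>i<n. \<eta> i * x i l)) = D * (\<Sum>l<p. g l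
        * label_sum n \<eta> x l) / sqrt (\<Sum>l<p. (g l)\<^sup>2)"
      unfolding label_sum_def[symmetric] sum_distrib_left sum_divide_distrib
      by (intro sum.cong) (simp_all add: spherical_def L2_set_def)
    moreover have "(\<Sum>l<p. (spherical p D g l)\<^sup>2) = D\<^sup>2 * (\<Sum>l<p. (g l)\<^sup>2) / (sqrt (\<Sum>l<p. (g l)\<^sup>2))\<^sup>2"
      unfolding sum_distrib_left sum_divide_distrib
      by (intro sum.cong) (simp_all add: spherical_def L2_set_def power_mult_distrib power_divide)
    ultimately show ?thesis unfolding spherical_likelihood_term_def by simp
  qed
  then show ?thesis unfolding obs_law_density[OF assms] by simp
qed

lemma measurable_obs_law_spherical:
  assumes "\<eta> \<in> labels n" and \<phi>: "\<phi> \<in> borel_measurable (obs_space n p)"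
  shows "(\<lambda>g. \<integral>\<^sup>+y. \<phi> y \<partial>obs_law n p 1 (spherical p D g) \<eta>) \<in> borel_measurable (std_gaussian_vector p)"
proof -
  interpret N: prob_space "noise n p"
    unfolding noise_def std_gaussian_vector_def by (intro prob_space_PiM prob_space_std_normal_power)
  show ?thesis
    unfolding obs_law_spherical[OF assms]
    by (rule N.borel_measurable_nn_integral) (rule measurable_spherical_likelihood_joint[OF \<phi>])
qed

lemma spherical_mixture_density:
  assumes "p > 0" "\<eta> \<in> labels n" and \<phi>: "\<phi> \<in> borel_measurable (obs_space n p)"
  shows "(\<integral>\<^sup>+g. \<integral>\<^sup>+y. \<phi> y \<partial>obs_law n p 1 (spherical p D g) \<eta> \<partial>std_gaussian_vector p) =
    (\<integral>\<^sup>+x. \<phi> x * spherical_likelihood n p D (L2_set (label_sum n \<eta> x) {..<p}) \<partial>noise n p)"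
proof -
  let ?h = "spherical_likelihood_term n D"
  interpret \<gamma>: prob_space "std_gaussian_vector p"
    unfolding std_gaussian_vector_def by (rule prob_space_std_normal_power)
  interpret N: prob_space "noise n p"
    unfolding noise_def by (intro prob_space_PiM) (rule \<gamma>.prob_space_axioms)
  interpret P: pair_sigma_finite "std_gaussian_vector p" "noise n p" ..
  have mx: "(\<lambda>g. ?h (\<Sum>l<p. g l * label_sum n \<eta> x l) (\<Sum>l<p. (g l)\<^sup>2)) \<in>
      borel_measurable (std_gaussian_vector p)" for x
  proof -
    have a: "(\<lambda>g. \<Sum>l<p. g l * label_sum n \<eta> x l) \<in> borel_measurable (std_gaussian_vector p)"
      by (intro borel_measurable_sum borel_measurable_times
          borel_measurable_const measurable_vector_component) auto
    have b: "(\<lambda>g. \<Sum>l<p. (g l)\<^sup>2) \<in> borel_measurable (std_gaussian_vector p)"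
      by (intro borel_measurable_sum borel_measurable_power measurable_vector_component) auto
    show ?thesis
      using measurable_compose[OF measurable_Pair[OF a b] measurable_spherical_likelihood_term[of n D]]
          by simp
  qed
  have "(\<integral>\<^sup>+g. \<integral>\<^sup>+y. \<phi> y \<partial>obs_law n p 1 (spherical p D g) \<eta> \<partial>std_gaussian_vector p) =
      (\<integral>\<^sup>+g. \<integral>\<^sup>+x. \<phi> x * ?h (\<Sum>l<p. g l * label_sum n \<eta> x l) (\<Sum>l<p. (g l)\<^sup>2) \<partial>noise n p
          \<partial>std_gaussian_vector p)"
    unfolding obs_law_spherical[OF assms(2) \<phi>] ..
  also have "\<dots> = (\<integral>\<^sup>+x. \<integral>\<^sup>+g. \<phi> x * ?h (\<Sum>l<p. g l * label_sum n \<eta> x l) (\<Sum>l<p. (g l)\<^sup>2)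
      \<partial>std_gaussian_vector p \<partial>noise n p)"
    by (rule P.Fubini'[symmetric]) (rule measurable_spherical_likelihood_joint[OF \<phi>])
  also have "\<dots> = (\<integral>\<^sup>+x. \<phi> x * spherical_likelihood n p D (L2_set (label_sum n \<eta> x) {..<p}) \<partial>noise n p)"
    unfolding nn_integral_cmult[OF mx] spherical_likelihood_rotation[OF assms(1)] ..
  finally show ?thesis .
qed

section \<open>Testing one label against its negation\<close>

lemma label_sum_flip:
  assumes "j < n"
  shows "label_sum n \<eta> x l = (\<Sum>k\<in>{..<n} - {j}. \<eta> k * x k l) + \<eta> j * x j l"
    and "label_sum n (\<eta>(j := - \<eta> j)) x l = (\<Sum>k\<in>{..<n} - {j}. \<eta> k * x k l) - \<eta> j * x j l"
proof -
  have "(\<Sum>k<n. f k) = (\<Sum>k\<in>{..<n} - {j}. f k) + f j" for f :: "nat \<Rightarrow> real"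
    using assms by (subst sum.remove[of _ j]) auto
  moreover have "(\<Sum>k\<in>{..<n} - {j}. (\<eta>(j := - \<eta> j)) k * x k l) = (\<Sum>k\<in>{..<n} - {j}. \<eta> k * x k l)"
    by (intro sum.cong) auto
  ultimately show "label_sum n \<eta> x l = (\<Sum>k\<in>{..<n} - {j}. \<eta> k * x k l) + \<eta> j * x j l"
    "label_sum n (\<eta>(j := - \<eta> j)) x l = (\<Sum>k\<in>{..<n} - {j}. \<eta> k * x k l) - \<eta> j * x j l"
    unfolding label_sum_def by simp_all
qed

text \<open>
  The statistic whose sign decides which of \<open>\<eta>\<close> and \<open>\<eta>\<close> with \<open>j\<close> flipped is favoured by the data.
\<close>
definition flip_alignment :: "nat \<Rightarrow> nat \<Rightarrow> (nat \<Rightarrow> real) \<Rightarrow> nat \<Rightarrow> (nat \<Rightarrow> nat \<Rightarrow> real) \<Rightarrow> real" where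
  "flip_alignment n p \<eta> j x = (\<Sum>l<p. \<eta> j * x j l * (\<Sum>k\<in>{..<n} - {j}. \<eta> k * x k l))"

text \<open>
  The polarisation identity \<open>\<parallel>a + b\<parallel>^2 = \<parallel>a - b\<parallel>^2 + 4 \<langle>a, b\<rangle>\<close>.
\<close>
lemma label_sum_norm_flip:
  assumes "j < n" "flip_alignment n p \<eta> j x \<le> 0"
  shows "L2_set (label_sum n \<eta> x) {..<p} \<le> L2_set (label_sum n (\<eta>(j := - \<eta> j)) x) {..<p}"
proof -
  define a where "a l = (\<Sum>k\<in>{..<n} - {j}. \<eta> k * x k l)" for l
  define b where "b l = \<eta> j * x j l" for l
  have "(a l + b l)\<^sup>2 = (a l - b l)\<^sup>2 + 4 * (b l * a l)" for l
    by (simp add: power2_eq_square algebra_simps)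
  then have "(\<Sum>l<p. (a l + b l)\<^sup>2) = (\<Sum>l<p. (a l - b l)\<^sup>2) + 4 * flip_alignment n p \<eta> j x"
    unfolding flip_alignment_def a_def[symmetric] b_def[symmetric]
    by (simp add: sum.distrib sum_distrib_left)
  moreover have "label_sum n \<eta> x l = a l + b l" "label_sum n (\<eta>(j := - \<eta> j)) x l = a l - b l" for l
    unfolding a_def b_def by (rule label_sum_flip[OF assms(1)])+
  ultimately have "(\<Sum>l<p. (label_sum n \<eta> x l)\<^sup>2) =
      (\<Sum>l<p. (label_sum n (\<eta>(j := - \<eta> j)) x l)\<^sup>2) + 4 * flip_alignment n p \<eta> j x"
    by (simp only:)
  then show ?thesis using assms(2) unfolding L2_set_def by simp
qed

lemma measurable_obs_component:
  assumes "i < n" "l < p"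
  shows "(\<lambda>x. x i l) \<in> borel_measurable (obs_space n p)"
  using measurable_noise_component[OF assms] measurable_cong_sets[OF sets_noise refl] by blast

lemma measurable_flip_alignment:
  assumes "j < n"
  shows "flip_alignment n p \<eta> j \<in> borel_measurable (obs_space n p)"
  unfolding flip_alignment_def[abs_def] using assms
  by (intro borel_measurable_sum borel_measurable_times
      borel_measurable_const measurable_obs_component) auto

lemma flip_in_labels: "\<eta> \<in> labels n \<Longrightarrow> j < n \<Longrightarrow> \<eta>(j := - \<eta> j) \<in> labels n"
  by (auto simp: labels_def PiE_iff extensional_def)

lemma borel_measurable_indicator_Compl:
  assumes "A \<in> sets M"
  shows "(indicator (- A) :: _ \<Rightarrow> ennreal) \<in> borel_measurable M"
proof -
  have "(\<lambda>y. 1 - indicator A y :: ennreal) \<in> borel_measurable M" using assms by measurable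
  moreover have "(\<lambda>y. 1 - indicator A y :: ennreal) = indicator (- A)"
    by (auto simp: fun_eq_iff split: split_indicator)
  ultimately show ?thesis by simp
qed

text \<open>
  Neyman and Pearson in the form needed here. For any test \<open>A\<close>, the two errors add up to at least the integral
  of the smaller of the two mixture densities, and on the event on the left this is the density under \<open>\<eta>\<close>.
\<close>
lemma spherical_mixture_testing:
  assumes "p > 0" "D \<ge> 0" "\<eta> \<in> labels n" "j < n" and A: "A \<in> sets (obs_space n p)"
  shows "(\<integral>\<^sup>+g. \<integral>\<^sup>+y. indicator {r. r \<le> 0} (flip_alignment n p \<eta> j y)
        \<partial>obs_law n p 1 (spherical p D g) \<eta> \<partial>std_gaussian_vector p) \<le>
    (\<integral>\<^sup>+g. \<integral>\<^sup>+y. indicator (- A) y \<partial>obs_law n p 1 (spherical p D g) \<eta> \<partial>std_gaussian_vector p) +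
    (\<integral>\<^sup>+g. \<integral>\<^sup>+y. indicator A y \<partial>obs_law n p 1 (spherical p D g) (\<eta>(j := - \<eta> j)) \<partial>std_gaussian_vector p)"
proof -
  let ?\<eta>' = "\<eta>(j := - \<eta> j)"
  let ?F = "\<lambda>\<eta> x. spherical_likelihood n p D (L2_set (label_sum n \<eta> x) {..<p})"
  have iA: "(indicator A :: _ \<Rightarrow> ennreal) \<in> borel_measurable (obs_space n p)"
    "(indicator (- A) :: _ \<Rightarrow> ennreal) \<in> borel_measurable (obs_space n p)"
    using A borel_measurable_indicator_Compl[OF A] by auto
  have iE: "(\<lambda>y. indicator {r. r \<le> 0} (flip_alignment n p \<eta> j y) :: ennreal) \<in>
      borel_measurable (obs_space n p)"
    by (intro measurable_compose[OF measurable_flip_alignment[OF assms(4)]]) measurable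
  have "(\<lambda>x. label_sum n \<eta> x l) \<in> borel_measurable (noise n p)" if "l < p" for l \<eta>
    unfolding label_sum_def using that
    by (intro borel_measurable_sum borel_measurable_times
        borel_measurable_const measurable_noise_component) auto
  then have L: "(\<lambda>x. L2_set (label_sum n \<eta> x) {..<p}) \<in> borel_measurable (noise n p)" for \<eta>
    unfolding L2_set_def
    by (intro measurable_compose[OF _ borel_measurable_sqrt] borel_measurable_sum
        borel_measurable_power) auto
  have F: "?F \<eta> \<in> borel_measurable (noise n p)" for \<eta>
    by (rule measurable_compose[OF L measurable_spherical_likelihood[OF assms(1)]])
  have m: "(\<lambda>x. \<phi> x * ?F \<eta> x) \<in> borel_measurable (noise n p)" if "\<phi> \<in> borel_measurable (obs_space n p)"
      for \<phi> \<eta>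
    using that F measurable_cong_sets[OF sets_noise refl] by (intro borel_measurable_times_ennreal) blast+
  show ?thesis
    unfolding spherical_mixture_density[OF assms(1,3) iE] spherical_mixture_density[OF assms(1,3) iA(2)]
      spherical_mixture_density[OF assms(1) flip_in_labels[OF assms(3,4)] iA(1)]
      nn_integral_add[OF m[OF iA(2)] m[OF iA(1)], symmetric]
  proof (intro nn_integral_mono)
    fix x
    have "?F \<eta> x \<le> ?F ?\<eta>' x" if "flip_alignment n p \<eta> j x \<le> 0"
      using label_sum_norm_flip[OF assms(4) that] by (intro spherical_likelihood_mono assms) auto
    then show "indicator {r. r \<le> 0} (flip_alignment n p \<eta> j x) * ?F \<eta> x \<le>
        indicator (- A) x * ?F \<eta> x + indicator A x * ?F ?\<eta>' x"
      by (auto split: split_indicator)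
  qed
qed

text \<open>
  Fubini's theorem separates the noise of observation \<open>j\<close> from the rest, whose weighted sum is
  \<open>\<surd>m z\<close> in law. After that \<open>sign_error_lower_bound\<close> applies; replacing \<open>p / m\<close> by \<open>p / n\<close> only
  decreases the tail.
\<close>
lemma flip_alignment_probability:
  fixes n p :: nat
  assumes "p > 0" "\<eta> \<in> labels n" "j < n" "n > 37" and D: "L2_set u {..<p} = D" "D \<ge> 1"
  shows "ennreal (normal_tail (D\<^sup>2 / sqrt (D\<^sup>2 + p / n) * snr_inflation (n - 1)) / 2) \<le>
    (\<integral>\<^sup>+y. indicator {r. r \<le> 0} (flip_alignment n p \<eta> j y) \<partial>obs_law n p 1 u \<eta>)"
proof -
  define m where "m = n - 1"
  define K where "K = {..<n} - {j}"
  define \<gamma> where "\<gamma> = std_gaussian_vector p"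
  define H where "H x w = (indicator {r. r \<le> 0} (\<Sum>l<p. (u l + \<eta> j * x l) * (m * u l + w l)) :: ennreal)"
    for x w :: "nat \<Rightarrow> real"
  interpret \<gamma>: prob_space \<gamma> unfolding \<gamma>_def std_gaussian_vector_def by (rule prob_space_std_normal_power)
  interpret P: pair_sigma_finite \<gamma> \<gamma> ..
  have m: "m > 36" and nK: "{..<n} = insert j K" "finite K" "j \<notin> K" "card K = m"
    using assms by (auto simp: m_def K_def)
  have \<eta>: "\<eta> k = 1 \<or> \<eta> k = -1" if "k < n" for k
    using assms(2) that by (auto simp: labels_def PiE_iff)
  then have sq: "\<eta> k * \<eta> k = 1" if "k < n" for k using that by fastforce
  have "L2_set \<eta> K = sqrt (\<Sum>k\<in>K. 1)"
    unfolding L2_set_def using sq by (intro arg_cong[where f=sqrt] sum.cong)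
        (auto simp: K_def power2_eq_square)
  then have L2K: "L2_set \<eta> K = sqrt m" by (simp add: nK)
  have comp: "(\<lambda>x. x l) \<in> borel_measurable (PiM {..<p} (\<lambda>_. borel :: real measure))" if "l < p" for l
    using that by (intro measurable_component_singleton) simp
  have vec: "(\<lambda>x. x l) \<in> borel_measurable \<gamma>" if "l < p" for l
    unfolding \<gamma>_def using that by (rule measurable_vector_component)
  have ind: "(\<lambda>x. indicator {r. r \<le> 0} (f x) :: ennreal) \<in> borel_measurable M" if "f \<in>
      borel_measurable M" for f :: "_ \<Rightarrow> real" and M
    using that by measurable
  have iE: "(\<lambda>y. indicator {r. r \<le> 0} (flip_alignment n p \<eta> j y) :: ennreal) \<in>
      borel_measurable (obs_space n p)"
    by (intro ind measurable_flip_alignment assms)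
  have H_meas: "H x \<in> borel_measurable (PiM {..<p} (\<lambda>_. borel))" for x
    unfolding H_def by (intro ind borel_measurable_sum borel_measurable_times borel_measurable_add
        borel_measurable_const comp) auto
  have obs: "indicator {r. r \<le> 0} (flip_alignment n p \<eta> j (observation n p 1 u \<eta> (\<xi>(j := x)))) =
      H x (\<lambda>l\<in>{..<p}. \<Sum>k\<in>K. \<eta> k * \<xi> k l)" for \<xi> x
  proof -
    have "(\<Sum>k\<in>K. \<eta> k * observation n p 1 u \<eta> (\<xi>(j := x)) k l) = m * u l + (\<Sum>k\<in>K. \<eta> k * \<xi> k l)"
        if "l < p" for l
    proof -
      have "\<eta> k * observation n p 1 u \<eta> (\<xi>(j := x)) k l = u l + \<eta> k * \<xi> k l" if "k \<in> K" for k
      proof -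
        have k: "k < n" "k \<noteq> j" using that by (auto simp: K_def)
        have "\<eta> k * observation n p 1 u \<eta> (\<xi>(j := x)) k l = (\<eta> k * \<eta> k) * u l + \<eta> k * \<xi> k l"
          using k \<open>l < p\<close> by (simp add: observation_def algebra_simps)
        then show ?thesis using sq[OF k(1)] by simp
      qed
      then show ?thesis by (simp add: sum.distrib nK cong: sum.cong)
    qed
    moreover have "\<eta> j * observation n p 1 u \<eta> (\<xi>(j := x)) j l = u l + \<eta> j * x l" if "l < p" for l
    proof -
      have "\<eta> j * observation n p 1 u \<eta> (\<xi>(j := x)) j l = (\<eta> j * \<eta> j) * u l + \<eta> j * x l"
        using \<open>j < n\<close> that by (simp add: observation_def algebra_simps)
      then show ?thesis using sq[OF \<open>j < n\<close>] by simp
    qed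
    ultimately have "flip_alignment n p \<eta> j (observation n p 1 u \<eta> (\<xi>(j := x))) =
        (\<Sum>l<p. (u l + \<eta> j * x l) * (m * u l + (\<lambda>l\<in>{..<p}. \<Sum>k\<in>K. \<eta> k * \<xi> k l) l))"
      unfolding flip_alignment_def K_def[symmetric] by (intro sum.cong refl) simp
    then show ?thesis unfolding H_def by simp
  qed
  have "(\<integral>\<^sup>+y. indicator {r. r \<le> 0} (flip_alignment n p \<eta> j y) \<partial>obs_law n p 1 u \<eta>) =
     (\<integral>\<^sup>+\<xi>. indicator {r. r \<le> 0} (flip_alignment n p \<eta> j (observation n p 1 u \<eta> \<xi>)) \<partial>noise n p)"
    unfolding obs_law_def by (intro nn_integral_distr measurable_observation) (simp add: iE)
  also have "\<dots> = (\<integral>\<^sup>+x. \<integral>\<^sup>+\<xi>. indicator {r. r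
      \<le> 0} (flip_alignment n p \<eta> j (observation n p 1 u \<eta> (\<xi>(j := x))))
      \<partial>PiM K (\<lambda>_. \<gamma>) \<partial>\<gamma>)"
    using measurable_compose[OF measurable_observation[of n p 1 u \<eta>] iE]
    unfolding noise_def nK(1) \<gamma>_def std_gaussian_vector_def
    by (intro std_normal_matrix.product_nn_integral_insert_rev nK)
  also have "\<dots> = (\<integral>\<^sup>+x. \<integral>\<^sup>+z. H x (\<lambda>l\<in>{..<p}. sqrt m * z l) \<partial>\<gamma> \<partial>\<gamma>)"
    unfolding obs \<gamma>_def std_gaussian_vector_def L2K[symmetric]
    by (intro nn_integral_cong std_normal_matrix_combination nK H_meas) simp
  also have "\<dots> = (\<integral>\<^sup>+z. \<integral>\<^sup>+x. H x (\<lambda>l\<in>{..<p}. sqrt m * z l) \<partial>\<gamma> \<partial>\<gamma>)"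
  proof (rule P.Fubini')
    show "(\<lambda>(z, x). H x (\<lambda>l\<in>{..<p}. sqrt m * z l)) \<in> borel_measurable (\<gamma> \<Otimes>\<^sub>M \<gamma>)"
      unfolding H_def case_prod_beta
      by (intro ind borel_measurable_sum borel_measurable_times borel_measurable_add borel_measurable_const)
         (auto intro!: borel_measurable_times measurable_compose[OF measurable_fst vec]
            measurable_compose[OF measurable_snd vec])
  qed
  also have "\<dots> = (\<integral>\<^sup>+z. \<integral>\<^sup>+x. indicator {r. r \<le> 0} (\<Sum>l<p. (u l + \<eta> j * x l) * (m * u l + sqrt m * z l))
      \<partial>\<gamma> \<partial>\<gamma>)"
    unfolding H_def by (intro nn_integral_cong arg_cong[where f="indicator _"] sum.cong) auto
  also have "\<dots> \<ge> ennreal (normal_tail (D\<^sup>2 / sqrt (D\<^sup>2 + p / m) * snr_inflation m) / 2)"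
    unfolding \<gamma>_def by (intro sign_error_lower_bound assms \<eta> m)
  finally have bound: "ennreal (normal_tail (D\<^sup>2 / sqrt (D\<^sup>2 + p / m) * snr_inflation m) / 2) \<le>
    (\<integral>\<^sup>+y. indicator {r. r \<le> 0} (flip_alignment n p \<eta> j y) \<partial>obs_law n p 1 u \<eta>)" .
  have "real p / n \<le> real p / m" using m by (intro divide_left_mono) (auto simp: m_def)
  then have "D\<^sup>2 / sqrt (D\<^sup>2 + p / m) \<le> D\<^sup>2 / sqrt (D\<^sup>2 + p / n)"
    using D(2) by (intro divide_left_mono mult_pos_pos real_sqrt_le_mono) (auto intro!: add_pos_nonneg)
  moreover have "snr_inflation m \<ge> 0"
  proof -
    have "6 / sqrt m \<le> 1" using real_sqrt_le_mono[of 36 m] m by (simp add: divide_le_eq)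
    then show ?thesis by (auto simp: snr_inflation_def intro!: divide_nonneg_nonneg)
  qed
  ultimately have "normal_tail (D\<^sup>2 / sqrt (D\<^sup>2 + p / n) * snr_inflation m) \<le>
      normal_tail (D\<^sup>2 / sqrt (D\<^sup>2 + p / m) * snr_inflation m)"
    by (intro normal_tail_antimono mult_right_mono)
  then have "ennreal (normal_tail (D\<^sup>2 / sqrt (D\<^sup>2 + p / n) * snr_inflation m) / 2) \<le>
      ennreal (normal_tail (D\<^sup>2 / sqrt (D\<^sup>2 + p / m) * snr_inflation m) / 2)"
    by (intro ennreal_leI divide_right_mono) simp_all
  then show ?thesis using bound unfolding m_def[symmetric] by (rule order.trans)
qed

section \<open>From pairs of labels to the loss\<close>

lemma label_cases: "\<eta> \<in> labels n \<Longrightarrow> i < n \<Longrightarrow> \<eta> i = 1 \<or> \<eta> i = -1"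
  by (auto simp: labels_def PiE_iff)

text \<open>
  Let \<open>s\<close> be the sum of the agreements \<open>\<eta>' i
      * \<eta> i\<close>. The number of wrong pairs is \<open>(n^2 - s^2) / 2\<close>, while the
  sum of absolute differences for the sign \<open>\<nu>\<close> is \<open>n - \<nu> s\<close>. The claim is then
  \<open>2 n (n - \<nu> s) - (n^2 - s^2) = (n - \<nu> s)^2 \<ge> 0\<close>.
\<close>
lemma loss_ge_misclassified_pairs:
  assumes "\<eta>' \<in> labels n" "\<eta> \<in> labels n"
  shows "(\<Sum>i<n. \<Sum>j<n. of_bool (\<eta>' i * \<eta>' j \<noteq> \<eta> i * \<eta> j)) \<le> real n * loss n \<eta>' \<eta>"
proof -
  define a where "a i = \<eta>' i * \<eta> i" for i
  define s where "s = (\<Sum>i<n. a i)"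
  have pair: "of_bool (\<eta>' i * \<eta>' j \<noteq> \<eta> i * \<eta> j) = (1 - a i * a j) / 2" if "i < n" "j < n" for i j
    using label_cases[OF assms(1) that(1)] label_cases[OF assms(1) that(2)]
      label_cases[OF assms(2) that(1)] label_cases[OF assms(2) that(2)]
    by (elim disjE) (simp_all add: a_def)
  have "(\<Sum>i<n. \<Sum>j<n. of_bool (\<eta>' i * \<eta>' j \<noteq> \<eta> i * \<eta> j)) = (\<Sum>i<n. \<Sum>j<n. (1 - a i * a j) / 2)"
    by (intro sum.cong refl pair) auto
  also have "\<dots> = ((real n)\<^sup>2 - s\<^sup>2) / 2"
    by (simp add: sum_divide_distrib[symmetric] sum_subtractf s_def sum_product power2_eq_square)
  also have "\<dots> \<le> real n * loss n \<eta>' \<eta>"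
  proof -
    have "((real n)\<^sup>2 - s\<^sup>2) / 2 \<le> real n * (\<Sum>j<n. \<bar>\<eta>' j - \<nu> * \<eta> j\<bar>)" if \<nu>: "\<nu> \<in> {-1, 1}" for \<nu> :: real
    proof -
      have "\<bar>\<eta>' j - \<nu> * \<eta> j\<bar> = 1 - \<nu> * a j" if "j < n" for j
        using label_cases[OF assms(1) that] label_cases[OF assms(2) that] \<nu> by (auto simp: a_def)
      then have sum: "(\<Sum>j<n. \<bar>\<eta>' j - \<nu> * \<eta> j\<bar>) = real n - \<nu> * s"
        by (simp add: sum_subtractf sum_distrib_left s_def)
      have "\<nu>\<^sup>2 = 1" using \<nu> by auto
      then have "2 * (real n * (real n - \<nu> * s)) - ((real n)\<^sup>2 - s\<^sup>2) = (real n - \<nu> * s)\<^sup>2"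
        by (simp add: power2_diff power_mult_distrib) (simp add: power2_eq_square algebra_simps)
      then have "((real n)\<^sup>2 - s\<^sup>2) / 2 \<le> real n * (real n - \<nu> * s)"
        using zero_le_power2[of "real n - \<nu> * s"]
        by (metis diff_ge_0_iff_ge divide_le_eq_numeral1(1) mult.commute)
      then show ?thesis unfolding sum .
    qed
    note bound = this[of "-1"] this[of 1]
    have "loss n \<eta>' \<eta> = min (\<Sum>j<n. \<bar>\<eta>' j - (- 1) * \<eta> j\<bar>) (\<Sum>j<n. \<bar>\<eta>' j - 1 * \<eta> j\<bar>)"
      unfolding loss_def by simp
    then show ?thesis using bound by (simp add: min_def)
  qed
  finally show ?thesis .
qed

definition right_pairs :: "nat \<Rightarrow> nat \<Rightarrow> ((nat \<Rightarrow> nat \<Rightarrow> real) \<Rightarrow> nat \<Rightarrow> real) \<Rightarrow> (nat \<Rightarrow> real) \<Rightarrow> nat \<Rightarrow> nat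
    \<Rightarrow> (nat \<Rightarrow> nat \<Rightarrow> real) set" where
  "right_pairs n p est \<eta> i j = {y \<in> space (obs_space n p). est y i * est y j = \<eta> i * \<eta> j}"

lemma sets_right_pairs:
  assumes "est \<in> estimators n p"
  shows "right_pairs n p est \<eta> i j \<in> sets (obs_space n p)"
proof -
  have "est -` {e \<in> labels n. e i * e j = \<eta> i * \<eta> j} \<inter> space (obs_space n p) \<in> sets (obs_space n p)"
    using assms unfolding estimators_def by (rule measurable_sets) auto
  also have "est -` {e \<in> labels n. e i * e j = \<eta> i * \<eta> j} \<inter> space (obs_space n p)
      = right_pairs n p est \<eta> i j"
    using measurable_space[of est "obs_space n p" "count_space (labels n)"] assms
    by (auto simp: right_pairs_def estimators_def)
  finally show ?thesis .
qed

lemma finite_labels: "finite (labels n)" and labels_nonempty: "labels n \<noteq> {}"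
proof -
  show "finite (labels n)" unfolding labels_def by (intro finite_PiE) auto
  have "(\<lambda>i\<in>{..<n}. 1) \<in> labels n" by (simp add: labels_def)
  then show "labels n \<noteq> {}" by blast
qed

definition pair_error :: "nat \<Rightarrow> nat \<Rightarrow> real \<Rightarrow> ((nat \<Rightarrow> nat \<Rightarrow> real) \<Rightarrow> nat \<Rightarrow> real) \<Rightarrow> (nat \<Rightarrow> real) \<Rightarrow> nat
    \<Rightarrow> nat \<Rightarrow> ennreal" where
  "pair_error n p D est \<eta> i j =
    (\<integral>\<^sup>+g. \<integral>\<^sup>+y. indicator (- right_pairs n p est \<eta> i j) y \<partial>obs_law n p 1 (spherical p D g) \<eta>
        \<partial>std_gaussian_vector p)"

text \<open>
  Being right about the pair under \<open>\<eta>\<close> means being wrong about it when \<open>\<eta> j\<close> is negated. So estimating the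
  product is a test between the two hypotheses, and the error of the test is controlled for almost
  every direction.
\<close>
lemma pair_error_flip:
  fixes n p :: nat
  assumes "p > 0" "n > 37" "D \<ge> 1" "est \<in> estimators n p" "\<eta> \<in> labels n" "i < n" "j < n" "i \<noteq> j"
  shows "ennreal (normal_tail (D\<^sup>2 / sqrt (D\<^sup>2 + p / n) * snr_inflation (n - 1)) / 2) \<le>
    pair_error n p D est \<eta> i j + pair_error n p D est (\<eta>(j := - \<eta> j)) i j"
proof -
  define b where "b = ennreal (normal_tail (D\<^sup>2 / sqrt (D\<^sup>2 + p / n) * snr_inflation (n - 1)) / 2)"
  let ?\<eta>' = "\<eta>(j := - \<eta> j)"
  interpret \<gamma>: prob_space "std_gaussian_vector p"
    unfolding std_gaussian_vector_def by (rule prob_space_std_normal_power)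
  have D0: "D \<ge> 0" using assms(3) by simp
  have "b = (\<integral>\<^sup>+g. b \<partial>std_gaussian_vector p)" by (simp add: \<gamma>.emeasure_space_1)
  also have "\<dots> \<le> (\<integral>\<^sup>+g. \<integral>\<^sup>+y. indicator {r. r \<le> 0} (flip_alignment n p \<eta> j y)
        \<partial>obs_law n p 1 (spherical p D g) \<eta> \<partial>std_gaussian_vector p)"
  proof (rule nn_integral_mono_AE)
    show "AE g in std_gaussian_vector p. b \<le> (\<integral>\<^sup>+y. indicator {r. r \<le> 0} (flip_alignment n p \<eta> j y)
        \<partial>obs_law n p 1 (spherical p D g) \<eta>)"
      using AE_L2_set_spherical[OF assms(1) D0]
    proof eventually_elim
      fix g assume "L2_set (spherical p D g) {..<p} = D"
      then show "b \<le> (\<integral>\<^sup>+y. indicator {r. r \<le> 0} (flip_alignment n p \<eta> j y)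
          \<partial>obs_law n p 1 (spherical p D g) \<eta>)"
        unfolding b_def by (rule flip_alignment_probability[OF assms(1,5,7,2) _ assms(3)])
    qed
  qed
  also have "\<dots> \<le> pair_error n p D est \<eta> i j +
    (\<integral>\<^sup>+g. \<integral>\<^sup>+y. indicator (right_pairs n p est \<eta> i j) y \<partial>obs_law n p 1 (spherical p D g) ?\<eta>'
        \<partial>std_gaussian_vector p)"
    unfolding pair_error_def using assms D0 by (intro spherical_mixture_testing sets_right_pairs)
  also have "(\<integral>\<^sup>+g. \<integral>\<^sup>+y. indicator (right_pairs n p est \<eta> i j) y \<partial>obs_law n p 1 (spherical p D g) ?\<eta>'
      \<partial>std_gaussian_vector p)
      \<le> pair_error n p D est ?\<eta>' i j"
  proof -
    have "right_pairs n p est \<eta> i j \<subseteq> - right_pairs n p est ?\<eta>' i j"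
      using label_cases[OF assms(5,6)] label_cases[OF assms(5,7)] assms(8) by (auto simp: right_pairs_def)
    then show ?thesis
      unfolding pair_error_def by (intro nn_integral_mono) (auto split: split_indicator)
  qed
  finally show ?thesis unfolding b_def by (simp add: add_left_mono)
qed

text \<open>
  For each direction the number of wrong pairs is at most \<open>n\<close> times the loss, so its expectation is at most
  \<open>n^2\<close> times the risk, and the bound survives averaging over the prior.
\<close>
lemma sum_pair_error_le:
  assumes "p > 0" "n > 0" "D \<ge> 0" and est: "est \<in> estimators n p" and \<eta>: "\<eta> \<in> labels n"
    and risk: "\<And>u. u \<in> extensional {..<p} \<Longrightarrow> L2_set u {..<p} = D \<Longrightarrow> risk n p 1 est u \<eta> \<le> M"
  shows "(\<Sum>i<n. \<Sum>j<n. pair_error n p D est \<eta> i j) \<le> ennreal ((real n)\<^sup>2 * M)"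
proof -
  let ?R = "\<lambda>i j. - right_pairs n p est \<eta> i j"
  interpret \<gamma>: prob_space "std_gaussian_vector p"
    unfolding std_gaussian_vector_def by (rule prob_space_std_normal_power)
  have ind: "(indicator (?R i j) :: _ \<Rightarrow> ennreal) \<in> borel_measurable (obs_space n p)" for i j
    by (intro borel_measurable_indicator_Compl sets_right_pairs est)
  have fixed: "(\<Sum>i<n. \<Sum>j<n. \<integral>\<^sup>+y. indicator (?R i j) y \<partial>obs_law n p 1 u \<eta>) \<le> ennreal ((real n)\<^sup>2
      * risk n p 1 est u \<eta>)" for u
  proof -
    let ?P = "obs_law n p 1 u \<eta>"
    interpret P: prob_space ?P by (rule prob_space_obs_law)
    have sets_P: "sets ?P = sets (obs_space n p)" by (simp add: obs_law_def)
    have est_space: "est y \<in> labels n" if "y \<in> space (obs_space n p)" for y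
      using est that unfolding estimators_def by (auto dest: measurable_space)
    have int: "integrable ?P (\<lambda>y. real n * loss n (est y) \<eta>)"
      using integrable_loss[OF est \<eta>] by simp
    have m: "(indicator (?R i j) :: _ \<Rightarrow> ennreal) \<in> borel_measurable ?P" for i j
      using ind measurable_cong_sets[OF sets_P refl] by blast
    have "(\<Sum>i<n. \<Sum>j<n. \<integral>\<^sup>+y. indicator (?R i j) y \<partial>?P) = (\<integral>\<^sup>+y. (\<Sum>i<n. \<Sum>j<n. indicator (?R i j) y) \<partial>?P)"
      using m by (simp add: nn_integral_sum borel_measurable_sum)
    also have "\<dots> \<le> (\<integral>\<^sup>+y. ennreal (real n * loss n (est y) \<eta>) \<partial>?P)"
    proof (rule nn_integral_mono)
      fix y assume "y \<in> space ?P"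
      then have y: "y \<in> space (obs_space n p)" by (simp add: obs_law_def)
      have "indicator (?R i j) y = ennreal (of_bool (est y i * est y j \<noteq> \<eta> i * \<eta> j))" for i j
        using y by (auto simp: right_pairs_def split: split_indicator)
      then have "(\<Sum>i<n. \<Sum>j<n. indicator (?R i j) y) =
          ennreal (\<Sum>i<n. \<Sum>j<n. of_bool (est y i * est y j \<noteq> \<eta> i * \<eta> j))"
        by (simp add: sum_ennreal sum_nonneg)
      also have "\<dots> \<le> ennreal (real n * loss n (est y) \<eta>)"
        by (intro ennreal_leI loss_ge_misclassified_pairs est_space y \<eta>)
      finally show "(\<Sum>i<n. \<Sum>j<n. indicator (?R i j) y) \<le> ennreal (real n * loss n (est y) \<eta>)" .
    qed
    also have "\<dots> = ennreal (\<integral>y. real n * loss n (est y) \<eta> \<partial>?P)"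
      using loss_bounds(1)[OF est_space \<eta>] by (intro nn_integral_eq_integral int AE_I2)
          (simp add: obs_law_def)
    also have "(\<integral>y. real n * loss n (est y) \<eta> \<partial>?P) = (real n)\<^sup>2 * risk n p 1 est u \<eta>"
      using assms(2) by (simp add: risk_def power2_eq_square)
    finally show ?thesis .
  qed
  have "(\<Sum>i<n. \<Sum>j<n. pair_error n p D est \<eta> i j) =
      (\<integral>\<^sup>+g. (\<Sum>i<n. \<Sum>j<n. \<integral>\<^sup>+y. indicator (?R i j) y \<partial>obs_law n p 1 (spherical p D g) \<eta>)
          \<partial>std_gaussian_vector p)"
    unfolding pair_error_def
    by (simp add: nn_integral_sum borel_measurable_sum measurable_obs_law_spherical[OF \<eta> ind])
  also have "\<dots> \<le> (\<integral>\<^sup>+g. ennreal ((real n)\<^sup>2 * M) \<partial>std_gaussian_vector p)"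
  proof (rule nn_integral_mono_AE)
    show "AE g in std_gaussian_vector p.
      (\<Sum>i<n. \<Sum>j<n. \<integral>\<^sup>+y. indicator (?R i j) y \<partial>obs_law n p 1 (spherical p D g) \<eta>) \<le> ennreal ((real n)\<^sup>2
          * M)"
      using AE_L2_set_spherical[OF assms(1,3)]
    proof eventually_elim
      fix g assume "L2_set (spherical p D g) {..<p} = D"
      then have "risk n p 1 est (spherical p D g) \<eta> \<le> M"
        by (intro risk) (simp add: spherical_def)
      then show "(\<Sum>i<n. \<Sum>j<n. \<integral>\<^sup>+y. indicator (?R i j) y \<partial>obs_law n p 1 (spherical p D g) \<eta>)
          \<le> ennreal ((real n)\<^sup>2 * M)"
        by (intro order.trans[OF fixed] ennreal_leI mult_left_mono) auto
    qed
  qed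
  also have "\<dots> = ennreal ((real n)\<^sup>2 * M)" by (simp add: \<gamma>.emeasure_space_1)
  finally show ?thesis .
qed

text \<open>
  Averaging over all labels pairs each \<open>\<eta>\<close> with its flip at \<open>j\<close>, so every pair \<open>i \<noteq> j\<close> has average error at
  least half of the bound \<open>b\<close> on the sum of the two errors, where \<open>b\<close> is itself half of the tail. The
  remaining factor \<open>1/2\<close> absorbs the proportion \<open>1 - 1/n\<close> of ordered pairs with \<open>i \<noteq> j\<close>.
\<close>
lemma unit_noise_minimax_bound:
  fixes n p :: nat
  assumes "p > 0" "n > 37" "D \<ge> 1" and est: "est \<in> estimators n p"
    and risk: "\<And>u \<eta>. u \<in> extensional {..<p} \<Longrightarrow> L2_set u {..<p} = D \<Longrightarrow> \<eta> \<in> labels n \<Longrightarrow> risk n p 1 est u \<eta> \<le> M"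
    and "M \<ge> 0"
  shows "normal_tail (D\<^sup>2 / sqrt (D\<^sup>2 + p / n) * snr_inflation (n - 1)) / 8 \<le> M"
proof -
  define b where "b = normal_tail (D\<^sup>2 / sqrt (D\<^sup>2 + p / n) * snr_inflation (n - 1)) / 2"
  define C where "C = real (card (labels n))"
  let ?W = "pair_error n p D est"
  have b: "b \<ge> 0" by (simp add: b_def normal_tail_def)
  have C: "C > 0" using finite_labels labels_nonempty by (auto simp: C_def card_gt_0_iff)
  have pair: "ennreal (C * b) \<le> 2 * (\<Sum>\<eta>\<in>labels n. ?W \<eta> i j)" if "i < n" "j < n" "i \<noteq> j" for i j
  proof -
    have "ennreal (C * b) = (\<Sum>\<eta>\<in>labels n. ennreal b)"
      using C b by (simp add: C_def ennreal_mult ennreal_of_nat_eq_real_of_nat)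
    also have "\<dots> \<le> (\<Sum>\<eta>\<in>labels n. ?W \<eta> i j + ?W (\<eta>(j := - \<eta> j)) i j)"
      unfolding b_def by (intro sum_mono pair_error_flip assms that)
    also have "\<dots> = (\<Sum>\<eta>\<in>labels n. ?W \<eta> i j) + (\<Sum>\<eta>\<in>labels n. ?W (\<eta>(j := - \<eta> j)) i j)"
      by (rule sum.distrib)
    also have "(\<Sum>\<eta>\<in>labels n. ?W (\<eta>(j := - \<eta> j)) i j) = (\<Sum>\<eta>\<in>labels n. ?W \<eta> i j)"
      using that by (intro sum.reindex_bij_witness[where i="\<lambda>\<eta>. \<eta>(j := - \<eta> j)" and j="\<lambda>\<eta>. \<eta>(j := - \<eta> j)"])
        (auto simp: flip_in_labels)
    finally show ?thesis by (simp add: mult_2)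
  qed
  have "ennreal (real n * (real n - 1) * (C * b)) = (\<Sum>i<n. \<Sum>j\<in>{..<n} - {i}. ennreal (C * b))"
    using C b assms(2) by (simp add: ennreal_mult ennreal_of_nat_eq_real_of_nat of_nat_diff mult.assoc)
  also have "\<dots> \<le> (\<Sum>i<n. \<Sum>j\<in>{..<n} - {i}. 2 * (\<Sum>\<eta>\<in>labels n. ?W \<eta> i j))"
    by (intro sum_mono pair) auto
  also have "\<dots> \<le> (\<Sum>i<n. \<Sum>j<n. 2 * (\<Sum>\<eta>\<in>labels n. ?W \<eta> i j))"
    by (intro sum_mono sum_mono2) auto
  also have "\<dots> = 2 * (\<Sum>\<eta>\<in>labels n. \<Sum>i<n. \<Sum>j<n. ?W \<eta> i j)"
    by (simp add: sum_distrib_left[symmetric] sum.swap[of _ _ "labels n"])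
  also have "\<dots> \<le> 2 * (\<Sum>\<eta>\<in>labels n. ennreal ((real n)\<^sup>2 * M))"
    using assms by (intro mult_left_mono sum_mono sum_pair_error_le risk) auto
  also have "\<dots> = ennreal (2 * (C * ((real n)\<^sup>2 * M)))"
    using assms(6) by (simp add: C_def ennreal_mult ennreal_of_nat_eq_real_of_nat)
  finally have "real n * (real n - 1) * (C * b) \<le> 2 * (C * ((real n)\<^sup>2 * M))"
    using C assms(6) by (subst (asm) ennreal_le_iff) auto
  then have "(real n * C) * ((real n - 1) * b) \<le> (real n * C) * (2 * real n * M)"
    by (simp add: power2_eq_square algebra_simps)
  then have "(real n - 1) * b \<le> 2 * real n * M"
    using C assms(2) by simp
  moreover have "real n / 2 * b \<le> (real n - 1) * b"
    using assms(2) b by (intro mult_right_mono) auto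
  ultimately have "real n * (b / 2) \<le> real n * (2 * M)" by simp
  then have "b / 2 \<le> 2 * M" using assms(2) by simp
  then show ?thesis by (simp add: b_def)
qed

section \<open>The minimax lower bound\<close>

lemma normal_tail_pos: "normal_tail t > 0"
proof -
  have "{t<..} \<notin> null_sets std_normal"
  proof
    assume "{t<..} \<in> null_sets std_normal"
    then have "AE x in lborel. x \<in> {t<..} \<longrightarrow> ennreal (std_normal_density x) = 0"
      by (simp add: null_sets_density_iff)
    then have "AE x in lborel. x \<notin> {t<..<t + 1}"
      by eventually_elim (auto simp: std_normal_density_def)
    then have "{t<..<t + 1} \<in> null_sets lborel" by (subst (asm) AE_iff_null_sets[symmetric]) auto
    then show False by (simp add: null_sets_def)
  qed
  then have "measure std_normal {t<..} \<noteq> 0"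
    by (auto simp: null_sets_def std_normal.emeasure_eq_measure)
  then show ?thesis unfolding normal_tail_def using measure_nonneg[of std_normal "{t<..}"] by linarith
qed

lemma normal_tail_le_1: "normal_tail t \<le> 1"
  unfolding normal_tail_def by (rule std_normal.prob_le_1)

definition rescale :: "nat \<Rightarrow> nat \<Rightarrow> real \<Rightarrow> (nat \<Rightarrow> nat \<Rightarrow> real) \<Rightarrow> nat \<Rightarrow> nat \<Rightarrow> real" where
  "rescale n p \<sigma> y = (\<lambda>i\<in>{..<n}. \<lambda>l\<in>{..<p}. \<sigma> * y i l)"

lemma measurable_rescale: "rescale n p \<sigma> \<in> obs_space n p \<rightarrow>\<^sub>M obs_space n p"
  unfolding rescale_def[abs_def] 
  by (subst (2) obs_space_def)
     (intro measurable_restrict borel_measurable_times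
         borel_measurable_const measurable_obs_component, auto)

text \<open>
  Dividing the data by \<open>\<sigma>\<close> turns an estimator for noise level \<open>\<sigma>\<close> into one for unit noise.
\<close>
lemma risk_rescale:
  assumes est: "est \<in> estimators n p" and \<eta>: "\<eta> \<in> labels n"
  shows "risk n p \<sigma> est (\<lambda>l\<in>{..<p}. \<sigma> * u l) \<eta> = risk n p 1 (\<lambda>y. est (rescale n p \<sigma> y)) u \<eta>"
proof -
  have est': "est \<in> obs_space n p \<rightarrow>\<^sub>M count_space (labels n)" using est by (simp add: estimators_def)
  have m: "(\<lambda>y. loss n (est y) \<eta>) \<in> borel_measurable (obs_space n p)"
    by (rule measurable_compose[OF est']) simp
  have "observation n p \<sigma> (\<lambda>l\<in>{..<p}. \<sigma> * u l) \<eta> \<xi> = rescale n p \<sigma> (observation n p 1 u \<eta> \<xi>)" for \<xi>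
    by (auto simp: observation_def rescale_def fun_eq_iff algebra_simps)
  then show ?thesis
    unfolding risk_def obs_law_def
    by (simp add: integral_distr[OF measurable_observation m]
        integral_distr[OF measurable_observation measurable_compose[OF measurable_rescale m]])
qed

text \<open>
  Every direction of norm \<open>\<sigma> D\<close> belongs to the parameter space, so \<open>\<sigma> D\<close> may exceed \<open>\<Delta>\<close>; this is used with
  \<open>D = 1\<close> when \<open>\<Delta> < \<sigma>\<close>.
\<close>
lemma minimax_risk_lower_bound:
  fixes n p :: nat
  assumes "p > 0" "n > 37" "\<sigma> > 0" "D \<ge> 1" "\<Delta> \<le> \<sigma> * D"
  shows "normal_tail (D\<^sup>2 / sqrt (D\<^sup>2 + p / n) * snr_inflation (n - 1)) / 8 \<le> minimax_risk n p \<sigma> \<Delta>"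
  unfolding minimax_risk_def
proof (rule cINF_greatest[OF estimators_nonempty])
  fix est assume est: "est \<in> estimators n p"
  define M where "M = (SUP (\<theta>, \<eta>)\<in>param_space n p \<Delta>. risk n p \<sigma> est \<theta> \<eta>)"
  have M: "risk n p \<sigma> est \<theta> \<eta> \<le> M" if "(\<theta>, \<eta>) \<in> param_space n p \<Delta>" for \<theta> \<eta>
    using cSUP_upper[OF that bdd_above_risk[OF _ est, of \<sigma> \<Delta>]] assms(2) by (simp add: M_def)
  have "M \<ge> 0"
  proof -
    obtain \<theta> \<eta> where *: "(\<theta>, \<eta>) \<in> param_space n p \<Delta>" using param_space_nonempty[OF assms(1), of n \<Delta>] by auto
    then have "0 \<le> risk n p \<sigma> est \<theta> \<eta>"
      using assms(2) by (intro risk_bounds est) (auto simp: param_space_def)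
    then show ?thesis using M[OF *] by simp
  qed
  have est': "(\<lambda>y. est (rescale n p \<sigma> y)) \<in> estimators n p"
    using est unfolding estimators_def by (intro measurable_compose[OF measurable_rescale])
  have "risk n p 1 (\<lambda>y. est (rescale n p \<sigma> y)) u \<eta> \<le> M"
    if u: "L2_set u {..<p} = D" and \<eta>: "\<eta> \<in> labels n" for u \<eta>
  proof -
    have "L2_set (\<lambda>l\<in>{..<p}. \<sigma> * u l) {..<p} = L2_set (\<lambda>l. \<sigma> * u l) {..<p}"
      by (intro L2_set_cong) auto
    also have "\<dots> = \<sigma> * D"
      using assms(3) u by (subst L2_set_right_distrib[symmetric]) auto
    finally have "(\<lambda>l\<in>{..<p}. \<sigma> * u l, \<eta>) \<in> param_space n p \<Delta>"
      using \<eta> assms(5) by (simp add: param_space_def)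
    then show ?thesis using M risk_rescale[OF est \<eta>] by metis
  qed
  then have "normal_tail (D\<^sup>2 / sqrt (D\<^sup>2 + p / n) * snr_inflation (n - 1)) / 8 \<le> M"
    by (intro unit_noise_minimax_bound[OF assms(1,2,4) est' _ \<open>M \<ge> 0\<close>]) blast
  then show "normal_tail (D\<^sup>2 / sqrt (D\<^sup>2 + p / n) * snr_inflation (n - 1)) / 8 \<le>
      (SUP (\<theta>, \<eta>)\<in>param_space n p \<Delta>. risk n p \<sigma> est \<theta> \<eta>)"
    unfolding M_def .
qed

lemma snr_inflation_tendsto: "snr_inflation \<longlonglongrightarrow> 1"
proof -
  have "(\<lambda>m. 1 / sqrt (real m)) \<longlonglongrightarrow> 0"
    by (intro tendsto_divide_0[OF tendsto_const] filterlim_at_top_imp_at_infinity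
        filterlim_compose[OF sqrt_at_top filterlim_real_sequentially])
  then have "(\<lambda>m. (1 + 2 * (1 / sqrt (real m))) / sqrt (1 - 6 * (1 / sqrt (real m)))) \<longlonglongrightarrow> (1 + 2
      * 0) / sqrt (1 - 6 * 0)"
    by (intro tendsto_intros) auto
  then show ?thesis by (simp add: snr_inflation_def[abs_def])
qed

theorem theorem2:
  shows "\<exists>c::real. c > 0 \<and>
    (\<forall>(p :: nat \<Rightarrow> nat) (\<sigma> :: nat \<Rightarrow> real) (\<Delta> :: nat \<Rightarrow> real).
      (\<forall>n. p n > 0 \<and> \<sigma> n > 0 \<and> \<Delta> n > 0) \<longrightarrow>
      (\<exists>\<epsilon> :: nat \<Rightarrow> real. \<epsilon> \<longlonglongrightarrow> 0 \<and>
        (\<forall>\<^sub>F n in sequentially.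
          minimax_risk n (p n) (\<sigma> n) (\<Delta> n)
            \<ge> c * normal_tail (snr n (p n) (\<sigma> n) (\<Delta> n) * (1 + \<epsilon> n)))))"
proof (intro exI[of _ "normal_tail 2 / 8"] conjI allI impI)
  show "normal_tail 2 / 8 > 0" using normal_tail_pos[of 2] by simp
  fix p :: "nat \<Rightarrow> nat" and \<sigma> \<Delta> :: "nat \<Rightarrow> real"
  assume pos: "\<forall>n. p n > 0 \<and> \<sigma> n > 0 \<and> \<Delta> n > 0"
  define \<epsilon> where "\<epsilon> n = snr_inflation (n - 1) - 1" for n
  have lim: "(\<lambda>n. snr_inflation (n - 1)) \<longlonglongrightarrow> 1"
    by (rule seq_offset_neg[OF snr_inflation_tendsto])
  have below: "\<forall>\<^sub>F n in sequentially. snr_inflation (n - 1) < 2"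
    and above: "\<forall>\<^sub>F n in sequentially. 0 < snr_inflation (n - 1)"
    by (rule order_tendstoD[OF lim], simp)+
  from lim have "\<epsilon> \<longlonglongrightarrow> 1 - 1" unfolding \<epsilon>_def[abs_def] by (intro tendsto_diff tendsto_const)
  then have "\<epsilon> \<longlonglongrightarrow> 0" by simp
  moreover have "\<forall>\<^sub>F n in sequentially. minimax_risk n (p n) (\<sigma> n) (\<Delta> n) \<ge>
      normal_tail 2 / 8 * normal_tail (snr n (p n) (\<sigma> n) (\<Delta> n) * (1 + \<epsilon> n))"
    using eventually_gt_at_top[of 37] below above
  proof eventually_elim
    fix n assume n: "37 < n" and infl: "snr_inflation (n - 1) < 2" "0 < snr_inflation (n - 1)"
    have pn: "p n > 0" "\<sigma> n > 0" "\<Delta> n > 0" using pos by auto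
    let ?t = "\<lambda>D. D\<^sup>2 / sqrt (D\<^sup>2 + p n / n) * snr_inflation (n - 1)"
    show "normal_tail 2 / 8 * normal_tail (snr n (p n) (\<sigma> n) (\<Delta> n) * (1 + \<epsilon> n)) \<le>
        minimax_risk n (p n) (\<sigma> n) (\<Delta> n)"
    proof (cases "\<sigma> n \<le> \<Delta> n")
      case True
      have "snr n (p n) (\<sigma> n) (\<Delta> n) * (1 + \<epsilon> n) = ?t (\<Delta> n / \<sigma> n)"
        by (simp add: snr_def \<epsilon>_def power_divide)
      moreover have "normal_tail (?t (\<Delta> n / \<sigma> n)) / 8 \<le> minimax_risk n (p n) (\<sigma> n) (\<Delta> n)"
        using True pn n by (intro minimax_risk_lower_bound) auto
      moreover have "normal_tail 2 * normal_tail (?t (\<Delta> n / \<sigma> n)) \<le> 1 * normal_tail (?t (\<Delta> n / \<sigma> n))"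
        by (intro mult_right_mono normal_tail_le_1) (simp add: less_imp_le[OF normal_tail_pos])
      ultimately show ?thesis by simp
    next
      case False
      have "1 \<le> sqrt (1 + p n / n)" by simp
      then have "1 / sqrt (1 + p n / n) \<le> 1"
        by (intro divide_le_eq_1_pos[THEN iffD2]) linarith+
      then have "?t 1 \<le> 1 * 2" using infl by (intro mult_mono) auto
      then have "normal_tail 2 \<le> normal_tail (?t 1)" by (intro normal_tail_antimono) simp
      moreover have "normal_tail (?t 1) / 8 \<le> minimax_risk n (p n) (\<sigma> n) (\<Delta> n)"
        using False pn n by (intro minimax_risk_lower_bound) auto
      moreover have "normal_tail 2 * normal_tail (snr n (p n) (\<sigma> n) (\<Delta> n) * (1 + \<epsilon> n)) \<le> normal_tail 2 * 1"
        by (intro mult_left_mono normal_tail_le_1) (simp add: less_imp_le[OF normal_tail_pos])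
      ultimately show ?thesis by simp
    qed
  qed
  ultimately show "\<exists>\<epsilon> :: nat \<Rightarrow> real. \<epsilon> \<longlonglongrightarrow> 0 \<and>
        (\<forall>\<^sub>F n in sequentially. minimax_risk n (p n) (\<sigma> n) (\<Delta> n)
            \<ge> normal_tail 2 / 8 * normal_tail (snr n (p n) (\<sigma> n) (\<Delta> n) * (1 + \<epsilon> n)))"
    by blast
qed

end
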